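(* Let $T$ be a visceral complete theory, $\mathfrak M=(M,\dots)$ an $\omega$-saturated model of $T$, and $\mathcal B$ a visceral definable uniform structure on $\mathfrak M$ (with the induced uniform topology on $M$ and product topology on $M^n$). If $B\subseteq M^n$ is an open ball and $f:B\to M$ is definable, then there is a nonempty open definable set $U\subseteq B$ such that $f$ is continuous on $U$.
   Context: "Definable" means definable with parameters. A base for a uniform structure on $M$ is a nonempty family $\mathcal{B}$ of subsets of $M\times M$ such that: for $D_1,D_2\in\mathcal B$ some $E\in\mathcal B$ satisfies $E\subseteq D_1\cap D_2$; every $D\in\mathcal B$ contains the diagonal; for $D\in\mathcal B$ some $E\in\mathcal B$ satisfies $E\subseteq D^{-1}=\{(y,x):(x,y)\in D\}$; for $D\in\mathcal B$ some $E\in\mathcal B$ satisfies $E\circ E\subseteq D$, where $E\circ E=\{(x,y):\exists z\,[(x,z),(z,y)\in E]\}$. A definable uniform structure is such a base of the form $\{\varphi(M^2;\bar b):\mathfrak M\models\psi(\bar b)\}$ for formulas $\varphi,\psi$, with symmetric members. Balls $D[x]=\{y:(x,y)\in D\}$ ($D\in\mathcal B$, $x\in M$) form a base of the uniform topology on $M$; an open ball in $M^n$ is a product $B_1\times\dots\times B_n$ of balls. $\mathcal B$ is visceral if (1) for every $D\in\mathcal B$, $x\in M$ there is $E\in\mathcal B$ with $E[x]\subsetneq D[x]$, and (2) every infinite definable subset of $M$ has nonempty interior. $T$ is visceral if some $\omega$-saturated model admits a visceral definable uniform structure. *)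

theory Defs
  imports "HOL-Analysis.Analysis"
begin

section \<open>First-order languages and structures\<close>

record ('f, 'r) lang =
  funs :: "'f set"
  fun_arity :: "'f \<Rightarrow> nat"
  rels :: "'r set"
  rel_arity :: "'r \<Rightarrow> nat"

datatype 'f trm = Var nat | Fn 'f "'f trm list"

datatype ('f, 'r) fm =
    Equal "'f trm" "'f trm"
  | Rel 'r "'f trm list"
  | Neg "('f, 'r) fm"
  | Conj "('f, 'r) fm" "('f, 'r) fm"
  | Exists nat "('f, 'r) fm"

fun trm_vars :: "'f trm \<Rightarrow> nat set" where
  "trm_vars (Var i) = {i}"
| "trm_vars (Fn f ts) = (\<Union>t\<in>set ts. trm_vars t)"

fun free_vars :: "('f, 'r) fm \<Rightarrow> nat set" where
  "free_vars (Equal s t) = trm_vars s \<union> trm_vars t"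
| "free_vars (Rel r ts) = (\<Union>t\<in>set ts. trm_vars t)"
| "free_vars (Neg \<phi>) = free_vars \<phi>"
| "free_vars (Conj \<phi> \<psi>) = free_vars \<phi> \<union> free_vars \<psi>"
| "free_vars (Exists i \<phi>) = free_vars \<phi> - {i}"

fun is_trm :: "('f, 'r) lang \<Rightarrow> 'f trm \<Rightarrow> bool" where
  "is_trm L (Var i) = True"
| "is_trm L (Fn f ts) \<longleftrightarrow>
     f \<in> funs L \<and> length ts = fun_arity L f \<and> (\<forall>t\<in>set ts. is_trm L t)"

fun is_fm :: "('f, 'r) lang \<Rightarrow> ('f, 'r) fm \<Rightarrow> bool" where
  "is_fm L (Equal s t) \<longleftrightarrow> is_trm L s \<and> is_trm L t"
| "is_fm L (Rel r ts) \<longleftrightarrow>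
     r \<in> rels L \<and> length ts = rel_arity L r \<and> (\<forall>t\<in>set ts. is_trm L t)"
| "is_fm L (Neg \<phi>) \<longleftrightarrow> is_fm L \<phi>"
| "is_fm L (Conj \<phi> \<psi>) \<longleftrightarrow> is_fm L \<phi> \<and> is_fm L \<psi>"
| "is_fm L (Exists i \<phi>) \<longleftrightarrow> is_fm L \<phi>"

definition sentences :: "('f, 'r) lang \<Rightarrow> ('f, 'r) fm set" where
  "sentences L = {\<phi>. is_fm L \<phi> \<and> free_vars \<phi> = {}}"

record ('f, 'r, 'm) struct =
  univ :: "'m set"
  fun_interp :: "'f \<Rightarrow> 'm list \<Rightarrow> 'm"
  rel_interp :: "'r \<Rightarrow> 'm list \<Rightarrow> bool"

definition is_structure :: "('f, 'r) lang \<Rightarrow> ('f, 'r, 'm) struct \<Rightarrow> bool" where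
  "is_structure L M \<longleftrightarrow> univ M \<noteq> {} \<and>
     (\<forall>f\<in>funs L. \<forall>as\<in>lists (univ M). length as = fun_arity L f \<longrightarrow> fun_interp M f as \<in> univ M)"

fun eval :: "('f, 'r, 'm) struct \<Rightarrow> (nat \<Rightarrow> 'm) \<Rightarrow> 'f trm \<Rightarrow> 'm" where
  "eval M e (Var i) = e i"
| "eval M e (Fn f ts) = fun_interp M f (map (eval M e) ts)"

fun sat :: "('f, 'r, 'm) struct \<Rightarrow> (nat \<Rightarrow> 'm) \<Rightarrow> ('f, 'r) fm \<Rightarrow> bool" where
  "sat M e (Equal s t) \<longleftrightarrow> eval M e s = eval M e t"
| "sat M e (Rel r ts) \<longleftrightarrow> rel_interp M r (map (eval M e) ts)"
| "sat M e (Neg \<phi>) \<longleftrightarrow> \<not> sat M e \<phi>"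
| "sat M e (Conj \<phi> \<psi>) \<longleftrightarrow> sat M e \<phi> \<and> sat M e \<psi>"
| "sat M e (Exists i \<phi>) \<longleftrightarrow> (\<exists>a\<in>univ M. sat M (e(i := a)) \<phi>)"

section \<open>Theories, models and saturation\<close>

definition is_model ::
  "('f, 'r) lang \<Rightarrow> ('f, 'r) fm set \<Rightarrow> ('f, 'r, 'm) struct \<Rightarrow> bool" where
  "is_model L T M \<longleftrightarrow> is_structure L M \<and>
     (\<forall>\<phi>\<in>T. \<forall>e\<in>UNIV \<rightarrow> univ M. sat M e \<phi>)"

text \<open>
  HOL cannot quantify over the models in all types. By the downward Loewenheim-Skolem theorem
  it is enough to let the models range over those whose universe is a set of formulas: the type
  of formulas is infinite and at least as large as the language.
\<close>

definition entails :: "('f, 'r) lang \<Rightarrow> ('f, 'r) fm set \<Rightarrow> ('f, 'r) fm \<Rightarrow> bool" where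
  "entails L T \<phi> \<longleftrightarrow>
     (\<forall>N :: ('f, 'r, ('f, 'r) fm) struct. is_model L T N \<longrightarrow> is_model L {\<phi>} N)"

definition satisfiable :: "('f, 'r) lang \<Rightarrow> ('f, 'r) fm set \<Rightarrow> bool" where
  "satisfiable L T \<longleftrightarrow> (\<exists>N :: ('f, 'r, ('f, 'r) fm) struct. is_model L T N)"

definition complete_theory :: "('f, 'r) lang \<Rightarrow> ('f, 'r) fm set \<Rightarrow> bool" where
  "complete_theory L T \<longleftrightarrow> T \<subseteq> sentences L \<and> satisfiable L T \<and>
     (\<forall>\<phi>\<in>sentences L. entails L T \<phi> \<or> entails L T (Neg \<phi>))"

text \<open>
  Variable \<open>0\<close> is the variable of the 1-type \<open>\<Gamma>\<close>; the finitely many variables in \<open>V\<close> stand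
  for the parameters, whose values are given by \<open>e\<close>.
\<close>

definition omega_saturated :: "('f, 'r) lang \<Rightarrow> ('f, 'r, 'm) struct \<Rightarrow> bool" where
  "omega_saturated L M \<longleftrightarrow>
     (\<forall>V. \<forall>e\<in>UNIV \<rightarrow> univ M. \<forall>\<Gamma>.
        finite V \<longrightarrow>
        \<Gamma> \<subseteq> {\<phi>. is_fm L \<phi> \<and> free_vars \<phi> \<subseteq> insert 0 V} \<longrightarrow>
        (\<forall>\<Delta>\<subseteq>\<Gamma>. finite \<Delta> \<longrightarrow> (\<exists>a\<in>univ M. \<forall>\<phi>\<in>\<Delta>. sat M (e(0 := a)) \<phi>)) \<longrightarrow>
        (\<exists>a\<in>univ M. \<forall>\<phi>\<in>\<Gamma>. sat M (e(0 := a)) \<phi>))"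

section \<open>Definability with parameters\<close>

text \<open>
  The power \<open>M\<^sup>n\<close> is the set of extensional functions on \<open>{..<n}\<close>, as in the library's
  product topology.
\<close>

definition power_univ :: "('f, 'r, 'm) struct \<Rightarrow> nat \<Rightarrow> (nat \<Rightarrow> 'm) set" where
  "power_univ M n = {..<n} \<rightarrow>\<^sub>E univ M"

text \<open>
  The free variables \<open>i \<ge> n\<close> of the formula are the parameters, with values \<open>e i\<close>.
\<close>

definition definable ::
  "('f, 'r) lang \<Rightarrow> ('f, 'r, 'm) struct \<Rightarrow> nat \<Rightarrow> (nat \<Rightarrow> 'm) set \<Rightarrow> bool" where
  "definable L M n A \<longleftrightarrow>
     (\<exists>\<phi>. \<exists>e\<in>UNIV \<rightarrow> univ M. is_fm L \<phi> \<and>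
        A = {x \<in> power_univ M n. sat M (override_on e x {..<n}) \<phi>})"

definition definable_subset ::
  "('f, 'r) lang \<Rightarrow> ('f, 'r, 'm) struct \<Rightarrow> 'm set \<Rightarrow> bool" where
  "definable_subset L M A \<longleftrightarrow> A \<subseteq> univ M \<and> definable L M 1 {x \<in> power_univ M 1. x 0 \<in> A}"

definition definable_function ::
  "('f, 'r) lang \<Rightarrow> ('f, 'r, 'm) struct \<Rightarrow> nat \<Rightarrow> (nat \<Rightarrow> 'm) set \<Rightarrow> ((nat \<Rightarrow> 'm) \<Rightarrow> 'm) \<Rightarrow> bool"
  where
  "definable_function L M n A f \<longleftrightarrow> A \<subseteq> power_univ M n \<and> f \<in> A \<rightarrow> univ M \<and>
     definable L M (Suc n)
       {z \<in> power_univ M (Suc n). restrict z {..<n} \<in> A \<and> z n = f (restrict z {..<n})}"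

section \<open>Uniform structures\<close>

definition uniform_base :: "'m set \<Rightarrow> ('m \<times> 'm) set set \<Rightarrow> bool" where
  "uniform_base X \<B> \<longleftrightarrow> \<B> \<noteq> {} \<and> (\<forall>D\<in>\<B>. D \<subseteq> X \<times> X) \<and>
     (\<forall>D\<^sub>1\<in>\<B>. \<forall>D\<^sub>2\<in>\<B>. \<exists>E\<in>\<B>. E \<subseteq> D\<^sub>1 \<inter> D\<^sub>2) \<and>
     (\<forall>D\<in>\<B>. Id_on X \<subseteq> D) \<and>
     (\<forall>D\<in>\<B>. \<exists>E\<in>\<B>. E \<subseteq> D\<inverse>) \<and>
     (\<forall>D\<in>\<B>. \<exists>E\<in>\<B>. E O E \<subseteq> D)"

text \<open>
  In \<open>\<phi>\<close> and \<open>\<psi>\<close> the variables \<open>i < k\<close> are those of the tuple \<open>b\<close>, and the variables \<open>k\<close> and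
  \<open>k + 1\<close> of \<open>\<phi>\<close> are the two coordinates of \<open>M\<^sup>2\<close>. Any further free variables are parameters
  with values given by \<open>e\<close>, since definability is definability with parameters.
\<close>

definition definable_uniform_structure ::
  "('f, 'r) lang \<Rightarrow> ('f, 'r, 'm) struct \<Rightarrow> ('m \<times> 'm) set set \<Rightarrow> bool" where
  "definable_uniform_structure L M \<B> \<longleftrightarrow> uniform_base (univ M) \<B> \<and> (\<forall>D\<in>\<B>. sym D) \<and>
     (\<exists>k \<phi> \<psi>. \<exists>e\<in>UNIV \<rightarrow> univ M. is_fm L \<phi> \<and> is_fm L \<psi> \<and>
        \<B> = {{(x, y) \<in> univ M \<times> univ M. sat M ((override_on e b {..<k})(k := x, Suc k := y)) \<phi>} | b.
              b \<in> power_univ M k \<and> sat M (override_on e b {..<k}) \<psi>})"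

text \<open>
  The ball \<open>D[x]\<close> is the image \<open>D `` {x}\<close>. The balls around \<open>x\<close> are the basic neighbourhoods of \<open>x\<close>
  in the uniform topology; the members of \<open>\<B>\<close> need not be open, so neither need the balls be.
\<close>

definition uniform_topology :: "'m set \<Rightarrow> ('m \<times> 'm) set set \<Rightarrow> 'm topology" where
  "uniform_topology X \<B> = topology (\<lambda>U. U \<subseteq> X \<and> (\<forall>x\<in>U. \<exists>D\<in>\<B>. D `` {x} \<subseteq> U))"

lemma openin_uniform_topology:
  assumes "uniform_base X \<B>"
  shows "openin (uniform_topology X \<B>) U \<longleftrightarrow> U \<subseteq> X \<and> (\<forall>x\<in>U. \<exists>D\<in>\<B>. D `` {x} \<subseteq> U)"
proof -
  have inter: "\<exists>E\<in>\<B>. E `` {x} \<subseteq> U \<inter> V"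
    if D: "D\<^sub>1 \<in> \<B>" "D\<^sub>1 `` {x} \<subseteq> U" "D\<^sub>2 \<in> \<B>" "D\<^sub>2 `` {x} \<subseteq> V" for D\<^sub>1 D\<^sub>2 x U V
  proof -
    have "\<forall>D\<^sub>1\<in>\<B>. \<forall>D\<^sub>2\<in>\<B>. \<exists>E\<in>\<B>. E \<subseteq> D\<^sub>1 \<inter> D\<^sub>2"
      using assms unfolding uniform_base_def by (elim conjE)
    then obtain E where "E \<in> \<B>" "E \<subseteq> D\<^sub>1 \<inter> D\<^sub>2" using D(1,3) by blast
    then show ?thesis using D by blast
  qed
  have "istopology (\<lambda>U. U \<subseteq> X \<and> (\<forall>x\<in>U. \<exists>D\<in>\<B>. D `` {x} \<subseteq> U))"
    unfolding istopology_def
  proof (intro conjI allI impI)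
    fix S T assume S: "S \<subseteq> X \<and> (\<forall>x\<in>S. \<exists>D\<in>\<B>. D `` {x} \<subseteq> S)"
      and T: "T \<subseteq> X \<and> (\<forall>x\<in>T. \<exists>D\<in>\<B>. D `` {x} \<subseteq> T)"
    show "S \<inter> T \<subseteq> X" using S by blast
    show "\<forall>x\<in>S \<inter> T. \<exists>D\<in>\<B>. D `` {x} \<subseteq> S \<inter> T"
    proof
      fix x assume "x \<in> S \<inter> T"
      then obtain D\<^sub>1 D\<^sub>2
        where "D\<^sub>1 \<in> \<B>" "D\<^sub>1 `` {x} \<subseteq> S" "D\<^sub>2 \<in> \<B>" "D\<^sub>2 `` {x} \<subseteq> T"
        using S T by blast
      then show "\<exists>D\<in>\<B>. D `` {x} \<subseteq> S \<inter> T" by (rule inter)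
    qed
  next
    fix K assume K: "\<forall>S\<in>K. S \<subseteq> X \<and> (\<forall>x\<in>S. \<exists>D\<in>\<B>. D `` {x} \<subseteq> S)"
    show "\<Union>K \<subseteq> X" using K by blast
    show "\<forall>x\<in>\<Union>K. \<exists>D\<in>\<B>. D `` {x} \<subseteq> \<Union>K"
    proof
      fix x assume "x \<in> \<Union>K"
      then obtain S where "S \<in> K" "x \<in> S" by blast
      moreover from this obtain D where "D \<in> \<B>" "D `` {x} \<subseteq> S" using K by blast
      ultimately show "\<exists>D\<in>\<B>. D `` {x} \<subseteq> \<Union>K" by blast
    qed
  qed
  then show ?thesis unfolding uniform_topology_def by (simp add: topology_inverse')
qed

lemma topspace_uniform_topology:
  assumes "uniform_base X \<B>"
  shows "topspace (uniform_topology X \<B>) = X"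
proof -
  have "\<B> \<noteq> {}" using assms unfolding uniform_base_def by (elim conjE)
  moreover have "\<forall>D\<in>\<B>. D \<subseteq> X \<times> X" using assms unfolding uniform_base_def by (elim conjE)
  ultimately obtain D where "D \<in> \<B>" "D \<subseteq> X \<times> X" by blast
  then have "openin (uniform_topology X \<B>) X"
    unfolding openin_uniform_topology[OF assms] by blast
  then show ?thesis
    using openin_uniform_topology[OF assms, of "topspace (uniform_topology X \<B>)"]
    by (auto dest: openin_subset)
qed

definition power_topology :: "'m set \<Rightarrow> ('m \<times> 'm) set set \<Rightarrow> nat \<Rightarrow> (nat \<Rightarrow> 'm) topology" where
  "power_topology X \<B> n = product_topology (\<lambda>_. uniform_topology X \<B>) {..<n}"

definition open_ball :: "'m set \<Rightarrow> ('m \<times> 'm) set set \<Rightarrow> nat \<Rightarrow> (nat \<Rightarrow> 'm) set \<Rightarrow> bool" where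
  "open_ball X \<B> n A \<longleftrightarrow>
     (\<exists>D x. (\<forall>i<n. D i \<in> \<B> \<and> x i \<in> X) \<and> A = (\<Pi>\<^sub>E i\<in>{..<n}. D i `` {x i}))"

section \<open>Viscerality\<close>

definition visceral ::
  "('f, 'r) lang \<Rightarrow> ('f, 'r, 'm) struct \<Rightarrow> ('m \<times> 'm) set set \<Rightarrow> bool" where
  "visceral L M \<B> \<longleftrightarrow> definable_uniform_structure L M \<B> \<and>
     (\<forall>D\<in>\<B>. \<forall>x\<in>univ M. \<exists>E\<in>\<B>. E `` {x} \<subset> D `` {x}) \<and>
     (\<forall>A. definable_subset L M A \<longrightarrow> infinite A \<longrightarrow>
        uniform_topology (univ M) \<B> interior_of A \<noteq> {})"

text \<open>
  The type argument names the type in which the \<open>\<omega>\<close>-saturated model is sought. In a hypothesis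
  with an otherwise unused type variable \<open>'n\<close> it amounts to the existence of such a model in some
  type.
\<close>

definition visceral_theory :: "'n itself \<Rightarrow> ('f, 'r) lang \<Rightarrow> ('f, 'r) fm set \<Rightarrow> bool" where
  "visceral_theory _ L T \<longleftrightarrow>
     (\<exists>(N :: ('f, 'r, 'n) struct) \<B>. is_model L T N \<and> omega_saturated L N \<and> visceral L N \<B>)"

end

theory Submission
  imports Defs
begin

text \<open>
  By \<open>\<omega>\<close>-saturation the finite fibres of a definable family of subsets of \<open>M\<close> are uniformly
  bounded. Hence a directed definable union with nonempty interior has a member with nonempty
  interior, in every power of \<open>M\<close>: for \<open>c \<in> M\<^sup>n\<close> only boundedly many \<open>z \<in> M\<close> are bad, so among
  sufficiently many fixed points of \<open>M\<close> one is good for all \<open>c\<close> in an open set. The same argument,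
  started from the fact that an infinite definable image in \<open>M\<close> contains a ball, shows that a
  definable function oscillates by less than a given entourage \<open>D\<close> on some open box inside any open
  set. If the continuity points of \<open>f\<close> had empty interior, then for some \<open>D\<close> the set of points
  where \<open>f\<close> oscillates by more than \<open>D\<close> in every neighbourhood would have nonempty interior, which
  is absurd.
\<close>

section \<open>Formulas and renaming of variables\<close>

text \<open>Viscerality speaks of subsets of M, the theorem of M^n. Points are split as
  \<open>z # c\<close>: for fixed \<open>c\<close>, an infinite set of bad \<open>z\<close> would
  contain a ball, and the one-variable argument finds a good point in it, so the bad sets are
  finite. Their bound is uniform in \<open>c\<close> because entourages are coded by tuples, which
  makes "some entourage works at \<open>z # c\<close>" first order. Choosing among N + 1 points
  covers a box of \<open>c\<close> by finitely many sets, each again a union over entourages;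
  therefore directed unions are treated for finitely many families at once. The gain is an entourage
  for the first coordinate that no longer depends on \<open>c\<close>, so that it combines with the
  induction hypothesis in the other coordinates. In the last step the directed family is indexed by
  the entourage at which continuity fails (smaller entourages fail at more points), and the
  continuity points join it as a constant family.\<close>

lemma finite_trm_vars: "finite (trm_vars t)"
  by (induction t) auto

lemma finite_free_vars: "finite (free_vars \<phi>)"
  by (induction \<phi>) (auto simp: finite_trm_vars)

lemma eval_cong: "(\<And>i. i \<in> trm_vars t \<Longrightarrow> e i = e' i) \<Longrightarrow> eval M e t = eval M e' t"
proof (induction t)
  case (Fn f ts)
  have "map (eval M e) ts = map (eval M e') ts"
    using Fn by (intro map_cong refl) auto
  then show ?case by (simp only: eval.simps)
qed simp

lemma sat_cong: "(\<And>i. i \<in> free_vars \<phi> \<Longrightarrow> e i = e' i) \<Longrightarrow> sat M e \<phi> = sat M e' \<phi>"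
proof (induction \<phi> arbitrary: e e')
  case (Equal s t)
  then show ?case using eval_cong[of s e e' M] eval_cong[of t e e' M] by auto
next
  case (Rel r ts)
  have "map (eval M e) ts = map (eval M e') ts"
    using Rel by (intro map_cong refl eval_cong) auto
  then show ?case by (simp only: sat.simps)
next
  case (Neg \<phi>)
  then show ?case by (metis free_vars.simps(3) sat.simps(3))
next
  case (Conj \<phi> \<psi>)
  have "sat M e \<phi> = sat M e' \<phi>" "sat M e \<psi> = sat M e' \<psi>"
    using Conj.prems by (auto intro!: Conj.IH)
  then show ?case by simp
next
  case (Exists i \<phi>)
  have "sat M (e(i := a)) \<phi> = sat M (e'(i := a)) \<phi>" for a
    using Exists.prems by (intro Exists.IH) auto
  then show ?case by simp
qed

fun rename_trm :: "(nat \<Rightarrow> nat) \<Rightarrow> 'f trm \<Rightarrow> 'f trm" where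
  "rename_trm \<rho> (Var i) = Var (\<rho> i)"
| "rename_trm \<rho> (Fn f ts) = Fn f (map (rename_trm \<rho>) ts)"

lemma trm_vars_rename: "trm_vars (rename_trm \<rho> t) = \<rho> ` trm_vars t"
  by (induction t) auto

lemma is_trm_rename: "is_trm L (rename_trm \<rho> t) = is_trm L t"
  by (induction t) auto

lemma eval_rename: "eval M e (rename_trm \<rho> t) = eval M (e \<circ> \<rho>) t"
  by (induction t) (auto simp: comp_def cong: map_cong)

text \<open>Stated as existence because bound variables change too: each quantifier gets a name
  fresh for the renamed free variables, so even a non-injective \<open>\<rho>\<close> causes no
  capture. The bound on free variables serves this induction and, later, the finite parameter sets
  of saturation.\<close>

lemma rename_formula:
  "\<exists>\<phi>'. is_fm L \<phi>' = is_fm L \<phi> \<and> free_vars \<phi>' \<subseteq> \<rho> ` free_vars \<phi> \<and>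
     (\<forall>e. sat M e \<phi>' = sat M (e \<circ> \<rho>) \<phi>)"
proof (induction \<phi> arbitrary: \<rho>)
  case (Equal s t)
  show ?case
    by (rule exI[of _ "Equal (rename_trm \<rho> s) (rename_trm \<rho> t)"])
      (auto simp: trm_vars_rename is_trm_rename eval_rename comp_def)
next
  case (Rel r ts)
  show ?case
    by (rule exI[of _ "Rel r (map (rename_trm \<rho>) ts)"])
      (auto simp: trm_vars_rename is_trm_rename eval_rename comp_def)
next
  case (Neg \<phi>)
  obtain \<phi>' where "is_fm L \<phi>' = is_fm L \<phi>" "free_vars \<phi>' \<subseteq> \<rho> ` free_vars \<phi>"
    "\<forall>e. sat M e \<phi>' = sat M (e \<circ> \<rho>) \<phi>"
    using Neg[of \<rho>] by blast
  then show ?case by (intro exI[of _ "Neg \<phi>'"]) (simp add: comp_def)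
next
  case (Conj \<phi> \<psi>)
  obtain \<phi>' where "is_fm L \<phi>' = is_fm L \<phi>" "free_vars \<phi>' \<subseteq> \<rho> ` free_vars \<phi>"
    "\<forall>e. sat M e \<phi>' = sat M (e \<circ> \<rho>) \<phi>"
    using Conj.IH(1)[of \<rho>] by blast
  moreover obtain \<psi>' where "is_fm L \<psi>' = is_fm L \<psi>" "free_vars \<psi>' \<subseteq> \<rho> ` free_vars \<psi>"
    "\<forall>e. sat M e \<psi>' = sat M (e \<circ> \<rho>) \<psi>"
    using Conj.IH(2)[of \<rho>] by blast
  ultimately show ?case by (intro exI[of _ "Conj \<phi>' \<psi>'"]) (auto simp: comp_def)
next
  case (Exists i \<phi>)
  obtain j where j: "j \<notin> \<rho> ` free_vars \<phi>"
    using ex_new_if_finite[OF infinite_UNIV_nat finite_imageI[OF finite_free_vars]] by blast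
  obtain \<phi>' where \<phi>': "is_fm L \<phi>' = is_fm L \<phi>" "free_vars \<phi>' \<subseteq> \<rho>(i := j) ` free_vars \<phi>"
    "\<And>e. sat M e \<phi>' = sat M (e \<circ> \<rho>(i := j)) \<phi>"
    using Exists[of "\<rho>(i := j)"] by blast
  have "sat M (e(j := a) \<circ> \<rho>(i := j)) \<phi> = sat M ((e \<circ> \<rho>)(i := a)) \<phi>" for e a
    using j by (intro sat_cong) auto
  then have "sat M e (Exists j \<phi>') = sat M (e \<circ> \<rho>) (Exists i \<phi>)" for e
    by (simp add: \<phi>'(3))
  moreover have "free_vars (Exists j \<phi>') \<subseteq> \<rho> ` free_vars (Exists i \<phi>)"
    using \<phi>'(2) by (auto split: if_splits)
  moreover have "is_fm L (Exists j \<phi>') = is_fm L (Exists i \<phi>)" using \<phi>'(1) by simp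
  ultimately show ?case by blast
qed

section \<open>Definable predicates of assignments\<close>

definition tuples :: "'m set \<Rightarrow> nat \<Rightarrow> 'm list set" where
  "tuples X n = {c. set c \<subseteq> X \<and> length c = n}"

lemma tuples_0 [simp]: "tuples X 0 = {[]}"
  by (auto simp: tuples_def)

lemma Cons_in_tuples [simp]: "a # c \<in> tuples X (Suc n) \<longleftrightarrow> a \<in> X \<and> c \<in> tuples X n"
  by (auto simp: tuples_def)

lemma tuples_Suc_iff: "y \<in> tuples X (Suc n) \<longleftrightarrow> (\<exists>a c. y = a # c \<and> a \<in> X \<and> c \<in> tuples X n)"
  by (cases y) (auto simp: tuples_def)

lemma map_upt_Suc_Cons: "map e [0..<Suc n] = e 0 # map (\<lambda>i. e (Suc i)) [0..<n]"
  by (simp only: map_upt_Suc)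

text \<open>A symbol is either a variable or a parameter.\<close>

definition symval :: "(nat \<Rightarrow> 'm) \<Rightarrow> nat + 'm \<Rightarrow> 'm" where
  "symval e = case_sum e id"

lemma symval_simps [simp]: "symval e (Inl j) = e j" "symval e (Inr a) = a"
  by (simp_all add: symval_def)

locale fo_structure =
  fixes L :: "('f, 'r) lang" and M :: "('f, 'r, 'm) struct"
  assumes nonempty: "univ M \<noteq> {}"
begin

abbreviation "U \<equiv> univ M"
abbreviation "envs \<equiv> UNIV \<rightarrow> U"

text \<open>
  Assignments are treated as de Bruijn contexts: a quantifier binds the variable \<open>0\<close> and shifts
  the others.
\<close>

definition dfn :: "'m set \<Rightarrow> ((nat \<Rightarrow> 'm) \<Rightarrow> bool) \<Rightarrow> bool" where
  "dfn A P \<longleftrightarrow> (\<exists>\<phi> s. is_fm L \<phi> \<and> (\<forall>i a. s i = Inr a \<longrightarrow> a \<in> A) \<and>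
     (\<forall>e\<in>envs. P e \<longleftrightarrow> sat M (symval e \<circ> s) \<phi>))"

text \<open>Compound terms are left out: substituting a symbol changes only what the variables of a
  formula stand for, and values of functions are introduced by quantifiers instead.\<close>

definition tm :: "'m set \<Rightarrow> ((nat \<Rightarrow> 'm) \<Rightarrow> 'm) \<Rightarrow> bool" where
  "tm A t \<longleftrightarrow> (\<exists>s. (\<forall>a. s = Inr a \<longrightarrow> a \<in> A) \<and> t = (\<lambda>e. symval e s))"

definition tms :: "'m set \<Rightarrow> nat \<Rightarrow> ((nat \<Rightarrow> 'm) \<Rightarrow> 'm list) \<Rightarrow> bool" where
  "tms A n t \<longleftrightarrow> (\<exists>ts. length ts = n \<and> (\<forall>u\<in>set ts. tm A u) \<and> t = (\<lambda>e. map (\<lambda>u. u e) ts))"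

section \<open>Closure properties of definable predicates\<close>

lemma tm_var: "tm A (\<lambda>e. e j)"
  unfolding tm_def by (rule exI[of _ "Inl j"]) simp

lemma tm_const: "a \<in> A \<Longrightarrow> tm A (\<lambda>e. a)"
  unfolding tm_def by (rule exI[of _ "Inr a"]) simp

lemma tms_Nil: "tms A 0 (\<lambda>e. [])"
  unfolding tms_def by simp

lemma tms_Cons:
  assumes "tm A x" "tms A n xs"
  shows "tms A (Suc n) (\<lambda>e. x e # xs e)"
proof -
  obtain ts where "length ts = n" "\<forall>u\<in>set ts. tm A u" "xs = (\<lambda>e. map (\<lambda>u. u e) ts)"
    using assms unfolding tms_def by blast
  then show ?thesis using assms unfolding tms_def by (intro exI[of _ "x # ts"]) simp
qed

lemma tms_map: "tms A (length is) (\<lambda>e. map (\<lambda>i. e (\<sigma> i)) is)"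
  unfolding tms_def by (rule exI[of _ "map (\<lambda>i e. e (\<sigma> i)) is"]) (auto intro: tm_var)

lemma tms_upt: "tms A n (\<lambda>e. map (\<lambda>i. e (\<sigma> i)) [0..<n])"
  using tms_map[of A "[0..<n]"] by simp

lemma tms_const: "c \<in> tuples A n \<Longrightarrow> tms A n (\<lambda>e. c)"
  unfolding tms_def tuples_def
  by (rule exI[of _ "map (\<lambda>a e. a) c"]) (auto intro: tm_const simp: comp_def)

lemma envs_symval: "e \<in> envs \<Longrightarrow> (\<And>a. s = Inr a \<Longrightarrow> a \<in> U) \<Longrightarrow> symval e s \<in> U"
  by (cases s) auto

lemma tm_in: "tm A t \<Longrightarrow> A \<subseteq> U \<Longrightarrow> e \<in> envs \<Longrightarrow> t e \<in> U"
  unfolding tm_def by (auto intro!: envs_symval)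

lemma dfn_cong: "(\<And>e. e \<in> envs \<Longrightarrow> P e = Q e) \<Longrightarrow> dfn A P = dfn A Q"
  unfolding dfn_def by (metis (mono_tags, lifting))

lemma dfn_mono: "dfn A P \<Longrightarrow> A \<subseteq> A' \<Longrightarrow> dfn A' P"
  unfolding dfn_def by (meson subsetD)

lemma dfn_subst:
  assumes "dfn A P" "\<And>i. tm A (t i)" "A \<subseteq> U"
  shows "dfn A (\<lambda>e. P (\<lambda>i. t i e))"
proof -
  obtain \<phi> s where \<phi>: "is_fm L \<phi>" "\<forall>i a. s i = Inr a \<longrightarrow> a \<in> A"
    "\<And>e. e \<in> envs \<Longrightarrow> P e \<longleftrightarrow> sat M (symval e \<circ> s) \<phi>"
    using assms(1) unfolding dfn_def by blast
  obtain u where u: "\<And>i a. u i = Inr a \<Longrightarrow> a \<in> A" "\<And>i. t i = (\<lambda>e. symval e (u i))"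
    using assms(2) unfolding tm_def by metis
  define s' where "s' i = (case s i of Inl j \<Rightarrow> u j | Inr a \<Rightarrow> Inr a)" for i
  have "P (\<lambda>i. t i e) \<longleftrightarrow> sat M (symval e \<circ> s') \<phi>" if "e \<in> envs" for e
  proof -
    have "(\<lambda>i. t i e) \<in> envs" using that assms tm_in by blast
    moreover have "symval (\<lambda>i. t i e) \<circ> s = symval e \<circ> s'"
      by (auto simp: s'_def u fun_eq_iff split: sum.splits)
    ultimately show ?thesis using \<phi>(3) by metis
  qed
  moreover have "\<forall>i a. s' i = Inr a \<longrightarrow> a \<in> A"
    using \<phi>(2) u(1) by (auto simp: s'_def split: sum.splits)
  ultimately show ?thesis unfolding dfn_def using \<phi>(1) by blast
qed

lemma dfn_sat:
  assumes "is_fm L \<phi>" "\<And>i. tm A (t i)"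
  shows "dfn A (\<lambda>e. sat M (\<lambda>i. t i e) \<phi>)"
proof -
  obtain u where u: "\<And>i a. u i = Inr a \<Longrightarrow> a \<in> A" "\<And>i. t i = (\<lambda>e. symval e (u i))"
    using assms(2) unfolding tm_def by metis
  then show ?thesis unfolding dfn_def using assms(1)
    by (intro exI[of _ \<phi>] exI[of _ u]) (auto simp: comp_def)
qed

lemma dfn_eq:
  assumes "tm A x" "tm A y"
  shows "dfn A (\<lambda>e. x e = y e)"
  using dfn_sat[of "Equal (Var 0) (Var 1)" A "\<lambda>i. if i = 0 then x else y"] assms by simp

lemma dfn_neg: "dfn A P \<Longrightarrow> dfn A (\<lambda>e. \<not> P e)"
  unfolding dfn_def by (metis is_fm.simps(3) sat.simps(3))

lemma dfn_conj:
  assumes "dfn A P" "dfn A Q"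
  shows "dfn A (\<lambda>e. P e \<and> Q e)"
proof -
  obtain \<phi> s where \<phi>: "is_fm L \<phi>" "\<forall>i a. s i = Inr a \<longrightarrow> a \<in> A"
    "\<And>e. e \<in> envs \<Longrightarrow> P e \<longleftrightarrow> sat M (symval e \<circ> s) \<phi>"
    using assms(1) unfolding dfn_def by blast
  obtain \<psi> t where \<psi>: "is_fm L \<psi>" "\<forall>i a. t i = Inr a \<longrightarrow> a \<in> A"
    "\<And>e. e \<in> envs \<Longrightarrow> Q e \<longleftrightarrow> sat M (symval e \<circ> t) \<psi>"
    using assms(2) unfolding dfn_def by blast
  \<comment> \<open>The two formulas may give the same variable different meanings, so they are
    moved to the even and to the odd variables.\<close>
  obtain \<phi>' where \<phi>': "is_fm L \<phi>'" "\<And>e. sat M e \<phi>' = sat M (e \<circ> (\<lambda>i. 2 * i)) \<phi>"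
    using rename_formula[of L \<phi> "\<lambda>i. 2 * i" M] \<phi>(1) by blast
  obtain \<psi>' where \<psi>': "is_fm L \<psi>'" "\<And>e. sat M e \<psi>' = sat M (e \<circ> (\<lambda>i. Suc (2 * i))) \<psi>"
    using rename_formula[of L \<psi> "\<lambda>i. Suc (2 * i)" M] \<psi>(1) by blast
  define r where "r i = (if even i then s (i div 2) else t (i div 2))" for i
  have "symval e \<circ> r \<circ> (\<lambda>i. 2 * i) = symval e \<circ> s"
    "symval e \<circ> r \<circ> (\<lambda>i. Suc (2 * i)) = symval e \<circ> t" for e
    by (simp_all add: r_def fun_eq_iff)
  then have "P e \<and> Q e \<longleftrightarrow> sat M (symval e \<circ> r) (Conj \<phi>' \<psi>')" if "e \<in> envs" for e
    using \<phi>(3)[OF that] \<psi>(3)[OF that] by (simp add: \<phi>'(2) \<psi>'(2))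
  moreover have "\<forall>i a. r i = Inr a \<longrightarrow> a \<in> A"
    using \<phi>(2) \<psi>(2) by (auto simp: r_def)
  moreover have "is_fm L (Conj \<phi>' \<psi>')" using \<phi>'(1) \<psi>'(1) by simp
  ultimately show ?thesis unfolding dfn_def by blast
qed

lemma dfn_disj: "dfn A P \<Longrightarrow> dfn A Q \<Longrightarrow> dfn A (\<lambda>e. P e \<or> Q e)"
  using dfn_neg[OF dfn_conj[OF dfn_neg[of A P] dfn_neg[of A Q]]] by simp

lemma dfn_imp: "dfn A P \<Longrightarrow> dfn A Q \<Longrightarrow> dfn A (\<lambda>e. P e \<longrightarrow> Q e)"
  using dfn_disj[OF dfn_neg[of A P], of Q] unfolding imp_conv_disj .

lemma dfn_const: "dfn A (\<lambda>e. b)"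
proof (cases b)
  case True
  then show ?thesis using dfn_eq[OF tm_var tm_var, of A 0 0] by simp
next
  case False
  then show ?thesis using dfn_neg[OF dfn_eq[OF tm_var tm_var, of A 0 0]] by simp
qed

lemma dfn_fin_ex:
  "finite I \<Longrightarrow> (\<And>i. i \<in> I \<Longrightarrow> dfn A (P i)) \<Longrightarrow> dfn A (\<lambda>e. \<exists>i\<in>I. P i e)"
proof (induction I rule: finite_induct)
  case empty
  then show ?case by (simp add: dfn_const)
next
  case (insert i I)
  then show ?case using dfn_disj[of A "P i" "\<lambda>e. \<exists>i\<in>I. P i e"] by simp
qed

lemma dfn_fin_all:
  "finite I \<Longrightarrow> (\<And>i. i \<in> I \<Longrightarrow> dfn A (P i)) \<Longrightarrow> dfn A (\<lambda>e. \<forall>i\<in>I. P i e)"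
  using dfn_neg[OF dfn_fin_ex[of I A "\<lambda>i e. \<not> P i e"]] dfn_neg by auto

lemma dfn_ex:
  assumes "dfn A (\<lambda>e. Q (\<lambda>i. e (Suc i)) (e 0))"
  shows "dfn A (\<lambda>e. \<exists>a\<in>U. Q e a)"
proof -
  obtain \<phi> s where \<phi>: "is_fm L \<phi>" "\<forall>i a. s i = Inr a \<longrightarrow> a \<in> A"
    "\<And>e. e \<in> envs \<Longrightarrow> Q (\<lambda>i. e (Suc i)) (e 0) \<longleftrightarrow> sat M (symval e \<circ> s) \<phi>"
    using assms unfolding dfn_def by blast
  \<comment> \<open>Several variables of \<open>\<phi>\<close> may stand for the context variable
    \<open>0\<close>; \<open>\<rho>\<close> merges them into one that \<open>Exists\<close> can bind
    and moves all others out of the way.\<close>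
  define \<rho> where "\<rho> i = (if s i = Inl 0 then 0 else Suc i)" for i
  obtain \<phi>' where \<phi>': "is_fm L \<phi>'" "\<And>e. sat M e \<phi>' = sat M (e \<circ> \<rho>) \<phi>"
    using rename_formula[of L \<phi> \<rho> M] \<phi>(1) by blast
  define t where "t i = (case s (i - 1) of Inl j \<Rightarrow> Inl (j - 1) | Inr a \<Rightarrow> Inr a)" for i
  have "Q e a \<longleftrightarrow> sat M ((symval e \<circ> t)(0 := a)) \<phi>'" if "e \<in> envs" "a \<in> U" for e a
  proof -
    have "case_nat a e \<in> envs" using that by (auto simp: Pi_def split: nat.splits)
    moreover have "symval (case_nat a e) \<circ> s = (symval e \<circ> t)(0 := a) \<circ> \<rho>"
      by (auto simp: t_def \<rho>_def fun_eq_iff symval_def split: sum.splits nat.splits)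
    ultimately show ?thesis using \<phi>(3)[of "case_nat a e"] \<phi>'(2) by simp
  qed
  then have "(\<exists>a\<in>U. Q e a) \<longleftrightarrow> sat M (symval e \<circ> t) (Exists 0 \<phi>')" if "e \<in> envs" for e
    using that by simp
  moreover have "\<forall>i a. t i = Inr a \<longrightarrow> a \<in> A"
    using \<phi>(2) by (auto simp: t_def split: sum.splits)
  moreover have "is_fm L (Exists 0 \<phi>')" using \<phi>'(1) by simp
  ultimately show ?thesis unfolding dfn_def by blast
qed

lemma dfn_all: "dfn A (\<lambda>e. Q (\<lambda>i. e (Suc i)) (e 0)) \<Longrightarrow> dfn A (\<lambda>e. \<forall>a\<in>U. Q e a)"
  using dfn_neg[OF dfn_ex[of A "\<lambda>e a. \<not> Q e a"]] dfn_neg by auto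

lemma dfn_ex_tuple:
  "dfn A (\<lambda>e. Q (\<lambda>i. e (i + n)) (map e [0..<n])) \<Longrightarrow> dfn A (\<lambda>e. \<exists>c\<in>tuples U n. Q e c)"
proof (induction n arbitrary: Q)
  case 0
  then show ?case by simp
next
  case (Suc n)
  have "dfn A (\<lambda>e. Q (\<lambda>i. e (Suc (i + n))) (e 0 # map (\<lambda>i. e (Suc i)) [0..<n]))"
    using Suc.prems unfolding map_upt_Suc_Cons by simp
  then have "dfn A (\<lambda>e. \<exists>a\<in>U. Q (\<lambda>i. e (i + n)) (a # map e [0..<n]))"
    by (rule dfn_ex)
  then have "dfn A (\<lambda>e. \<exists>c\<in>tuples U n. \<exists>a\<in>U. Q e (a # c))"
    by (rule Suc.IH)
  moreover have "(\<exists>c\<in>tuples U n. \<exists>a\<in>U. Q e (a # c)) \<longleftrightarrow> (\<exists>c\<in>tuples U (Suc n). Q e c)" for e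
    unfolding Bex_def tuples_Suc_iff by blast
  ultimately show ?case by simp
qed

lemma dfn_all_tuple:
  "dfn A (\<lambda>e. Q (\<lambda>i. e (i + n)) (map e [0..<n])) \<Longrightarrow> dfn A (\<lambda>e. \<forall>c\<in>tuples U n. Q e c)"
  using dfn_neg[OF dfn_ex_tuple[of A "\<lambda>e c. \<not> Q e c"]] dfn_neg by auto

lemma dfn_rel:
  assumes "dfn A (\<lambda>e. R (map e [0..<n]))" "tms A n t" "A \<subseteq> U"
  shows "dfn A (\<lambda>e. R (t e))"
proof -
  obtain ts where ts: "length ts = n" "\<forall>u\<in>set ts. tm A u" "t = (\<lambda>e. map (\<lambda>u. u e) ts)"
    using assms(2) unfolding tms_def by blast
  define s where "s i = (if i < n then ts ! i else (\<lambda>e. e 0))" for i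
  have "tm A (s i)" for i
    using ts tm_var by (auto simp: s_def)
  moreover have "map (\<lambda>i. s i e) [0..<n] = t e" for e
    using ts by (auto simp: s_def intro!: nth_equalityI)
  ultimately show ?thesis
    using dfn_subst[OF assms(1), of s] assms(3) by simp
qed

text \<open>Unlike \<open>k \<le> card\<close>, this also holds for infinite sets.\<close>

definition at_least :: "nat \<Rightarrow> ('m \<Rightarrow> bool) \<Rightarrow> bool" where
  "at_least k P \<longleftrightarrow> (\<exists>F\<subseteq>{z \<in> U. P z}. finite F \<and> card F = k)"

lemma at_least_Suc: "at_least (Suc k) P \<longleftrightarrow> (\<exists>z\<in>U. P z \<and> at_least k (\<lambda>w. P w \<and> w \<noteq> z))"
proof
  assume "at_least (Suc k) P"
  then obtain F where F: "F \<subseteq> {z \<in> U. P z}" "finite F" "card F = Suc k"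
    unfolding at_least_def by blast
  then obtain z where "z \<in> F" by fastforce
  then have "F - {z} \<subseteq> {w \<in> U. P w \<and> w \<noteq> z}" "finite (F - {z})" "card (F - {z}) = k"
    using F by auto
  then show "\<exists>z\<in>U. P z \<and> at_least k (\<lambda>w. P w \<and> w \<noteq> z)"
    unfolding at_least_def using F(1) \<open>z \<in> F\<close> by blast
next
  assume "\<exists>z\<in>U. P z \<and> at_least k (\<lambda>w. P w \<and> w \<noteq> z)"
  then obtain z F where "z \<in> U" "P z" "F \<subseteq> {w \<in> U. P w \<and> w \<noteq> z}" "finite F" "card F = k"
    unfolding at_least_def by blast
  moreover from this have "z \<notin> F" by blast
  ultimately show "at_least (Suc k) P"
    unfolding at_least_def by (intro exI[of _ "insert z F"]) auto
qed

lemma at_least_antimono: "at_least k P \<Longrightarrow> j \<le> k \<Longrightarrow> at_least j P"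
  unfolding at_least_def by (meson finite_subset obtain_subset_with_card_n order_trans)

lemma infinite_if_at_least: "(\<And>k. at_least k P) \<Longrightarrow> infinite {z \<in> U. P z}"
  unfolding at_least_def by (metis card_mono not_less_eq_eq order_refl)

text \<open>Each fixed \<open>k\<close> unwinds into \<open>k\<close> nested quantifiers.
  \<open>P\<close> is arbitrary in the induction because every quantifier adds the condition of
  differing from the point just chosen.\<close>

lemma dfn_at_least:
  "dfn A (\<lambda>e. P (\<lambda>i. e (Suc i)) (e 0)) \<Longrightarrow> A \<subseteq> U \<Longrightarrow> dfn A (\<lambda>e. at_least k (P e))"
proof (induction k arbitrary: P)
  case 0
  have "at_least 0 (P e)" for e
    unfolding at_least_def by (rule exI[of _ "{}"]) simp
  then show ?case by (simp add: dfn_const)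
next
  case (Suc k)
  \<comment> \<open>Variable \<open>0\<close> is the point \<open>w\<close> still to be counted and
    variable \<open>1\<close> the chosen \<open>z\<close>; the context of \<open>P\<close> starts
    after both.\<close>
  have "dfn A (\<lambda>e. P (\<lambda>i. e (Suc (Suc i))) (e 0))"
    using dfn_subst[OF Suc.prems(1), of "\<lambda>i. if i = 0 then (\<lambda>e. e 0) else (\<lambda>e. e (Suc i))"] Suc.prems(2)
    by (simp add: tm_var)
  then have "dfn A (\<lambda>e. P (\<lambda>i. e (Suc (Suc i))) (e 0) \<and> e 0 \<noteq> e (Suc 0))"
    by (intro dfn_conj dfn_neg dfn_eq tm_var)
  then have "dfn A (\<lambda>e. at_least k (\<lambda>w. P (\<lambda>i. e (Suc i)) w \<and> w \<noteq> e 0))"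
    using Suc.IH[of "\<lambda>e w. P (\<lambda>i. e (Suc i)) w \<and> w \<noteq> e 0"] Suc.prems(2) by simp
  then have "dfn A (\<lambda>e. \<exists>z\<in>U. P e z \<and> at_least k (\<lambda>w. P e w \<and> w \<noteq> z))"
    by (intro dfn_ex dfn_conj Suc.prems)
  then show ?case by (simp add: at_least_Suc)
qed

text \<open>Saturation admits finitely many parameters, while definability over \<open>U\<close>
  allows all of them. A formula has finitely many free variables, and the symbols at the others can
  be reset to a plain variable.\<close>

lemma dfn_finite_parameters:
  assumes "dfn A P"
  obtains A' where "finite A'" "A' \<subseteq> A" "dfn A' P"
proof -
  obtain \<phi> s where \<phi>: "is_fm L \<phi>" "\<forall>i a. s i = Inr a \<longrightarrow> a \<in> A"
    "\<And>e. e \<in> envs \<Longrightarrow> P e \<longleftrightarrow> sat M (symval e \<circ> s) \<phi>"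
    using assms unfolding dfn_def by blast
  define t where "t i = (if i \<in> free_vars \<phi> then s i else Inl 0)" for i
  define A' where "A' = {a. \<exists>i\<in>free_vars \<phi>. s i = Inr a}"
  have "A' \<subseteq> (\<lambda>i. projr (s i)) ` free_vars \<phi>"
    unfolding A'_def by force
  then have "finite A'" using finite_free_vars finite_surj by blast
  moreover have "A' \<subseteq> A" using \<phi>(2) by (auto simp: A'_def)
  moreover have "sat M (symval e \<circ> s) \<phi> = sat M (symval e \<circ> t) \<phi>" for e
    by (intro sat_cong) (simp add: t_def)
  then have "dfn A' P" unfolding dfn_def
    using \<phi> by (intro exI[of _ \<phi>] exI[of _ t]) (auto simp: t_def A'_def)
  ultimately show thesis using that by blast
qed

lemma definable_if_dfn:
  assumes P: "dfn U P" and R: "\<And>x e. x \<in> power_univ M n \<Longrightarrow> e \<in> envs \<Longrightarrow>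
    (\<And>i. i < n \<Longrightarrow> e i = x i) \<Longrightarrow> R x \<longleftrightarrow> P e"
  shows "definable L M n {x \<in> power_univ M n. R x}"
proof -
  obtain \<phi> s where \<phi>: "is_fm L \<phi>" "\<And>i a. s i = Inr a \<Longrightarrow> a \<in> U"
    "\<And>e. e \<in> envs \<Longrightarrow> P e \<longleftrightarrow> sat M (symval e \<circ> s) \<phi>"
    using P unfolding dfn_def by blast
  obtain a where a: "a \<in> U" using nonempty by blast
  \<comment> \<open>Context variables below \<open>n\<close> stay coordinates. Parameters and later
    context variables go to the places \<open>n + i\<close>, whose values \<open>e0\<close> fixes;
    the latter receive the default \<open>a\<close>, in agreement with \<open>e\<close>
    below.\<close>
  define \<rho> where "\<rho> i = (case s i of Inl j \<Rightarrow> if j < n then j else n + i | Inr _ \<Rightarrow> n + i)" for i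
  define e0 where "e0 i = (case s (i - n) of Inl j \<Rightarrow> a | Inr b \<Rightarrow> b)" for i
  have e0: "e0 \<in> envs" using \<phi>(2) a by (auto simp: e0_def split: sum.splits)
  obtain \<phi>' where \<phi>': "is_fm L \<phi>'" "\<And>e. sat M e \<phi>' = sat M (e \<circ> \<rho>) \<phi>"
    using rename_formula[of L \<phi> \<rho> M] \<phi>(1) by blast
  have "R x \<longleftrightarrow> sat M (override_on e0 x {..<n}) \<phi>'" if x: "x \<in> power_univ M n" for x
  proof -
    define e where "e = override_on (\<lambda>_. a) x {..<n}"
    have "e \<in> envs" using x a by (auto simp: e_def override_on_def power_univ_def PiE_def Pi_def)
    moreover have "symval e \<circ> s = override_on e0 x {..<n} \<circ> \<rho>"
      by (auto simp: e_def \<rho>_def e0_def override_on_def fun_eq_iff split: sum.splits)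
    ultimately show ?thesis using R[of x e] x \<phi>(3) \<phi>'(2) by (simp add: e_def)
  qed
  then have "{x \<in> power_univ M n. R x} =
      {x \<in> power_univ M n. sat M (override_on e0 x {..<n}) \<phi>'}" by blast
  then show ?thesis unfolding definable_def using e0 \<phi>'(1) by blast
qed

lemma dfn_if_definable:
  assumes "definable L M n A"
  shows "dfn U (\<lambda>e. restrict e {..<n} \<in> A)"
proof -
  obtain \<phi> e0 where \<phi>: "e0 \<in> envs" "is_fm L \<phi>"
    "A = {x \<in> power_univ M n. sat M (override_on e0 x {..<n}) \<phi>}"
    using assms unfolding definable_def by blast
  have "dfn U (\<lambda>e. sat M (\<lambda>i. (if i < n then (\<lambda>e. e i) else (\<lambda>e. e0 i)) e) \<phi>)"
    using \<phi>(1) by (intro dfn_sat \<phi>(2)) (auto intro: tm_var tm_const)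
  moreover have "override_on e0 (restrict e {..<n}) {..<n} =
      (\<lambda>i. (if i < n then (\<lambda>e. e i) else (\<lambda>e. e0 i)) e)" for e
    by (auto simp: override_on_def)
  moreover have "restrict e {..<n} \<in> power_univ M n" if "e \<in> envs" for e
    using that by (auto simp: power_univ_def)
  ultimately show ?thesis
    using dfn_cong[of "\<lambda>e. restrict e {..<n} \<in> A"] unfolding \<phi>(3) by simp
qed

lemma dfn_tm:
  assumes "dfn A (\<lambda>e. P (e 0))" "tm A t" "A \<subseteq> U"
  shows "dfn A (\<lambda>e. P (t e))"
  using dfn_subst[OF assms(1), of "\<lambda>_. t"] assms by simp

section \<open>Saturation and uniform bounds on finite fibres\<close>

text \<open>Saturation for a type given by predicates. A countable type is enough: it will say, for
  every \<open>k\<close>, that a coordinate extends to a tuple whose fibre has at least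
  \<open>k\<close> points.\<close>

lemma omega_saturated_countable:
  assumes sat: "omega_saturated L M"
    and A: "finite A" "A \<subseteq> U"
    and Q: "\<And>k :: nat. dfn A (\<lambda>e. Q k (e 0))"
    and fin: "\<And>K. finite K \<Longrightarrow> \<exists>a\<in>U. \<forall>k\<in>K. Q k a"
  shows "\<exists>a\<in>U. \<forall>k. Q k a"
proof -
  obtain a0 where a0: "a0 \<in> U" using nonempty by blast
  obtain as where as: "set as = A" using A(1) finite_list by blast
  define idx where "idx a = (SOME i. i < length as \<and> as ! i = a)" for a
  have idx: "idx a < length as \<and> as ! idx a = a" if "a \<in> A" for a
    unfolding idx_def by (rule someI_ex) (use that as in \<open>auto simp: in_set_conv_nth\<close>)
  \<comment> \<open>The parameters become the values of the variables \<open>1\<close> to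
    \<open>length as\<close>, since variable \<open>0\<close> is that of the type.\<close>
  define e0 where "e0 i = (if 0 < i \<and> i \<le> length as then as ! (i - 1) else a0)" for i
  have e0: "e0 \<in> envs"
    using a0 as A(2) by (auto simp: e0_def) (metis Suc_pred less_eq_Suc_le nth_mem subsetD)
  have "\<exists>\<phi>. is_fm L \<phi> \<and> free_vars \<phi> \<subseteq> insert 0 {1..length as} \<and>
      (\<forall>a\<in>U. sat M (e0(0 := a)) \<phi> \<longleftrightarrow> Q k a)" for k
  proof -
    obtain \<phi> s where \<phi>: "is_fm L \<phi>" "\<And>i a. s i = Inr a \<Longrightarrow> a \<in> A"
      "\<And>e. e \<in> envs \<Longrightarrow> Q k (e 0) \<longleftrightarrow> sat M (symval e \<circ> s) \<phi>"
      using Q[of k] unfolding dfn_def by blast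
    \<comment> \<open>\<open>Q k\<close> looks at \<open>e 0\<close> alone, so it can be tested in
      the assignment constantly \<open>a\<close>; hence all context variables may be merged into
      variable \<open>0\<close>.\<close>
    define \<rho> where "\<rho> i = (case s i of Inl _ \<Rightarrow> 0 | Inr a \<Rightarrow> Suc (idx a))" for i
    obtain \<phi>' where \<phi>': "is_fm L \<phi>'" "free_vars \<phi>' \<subseteq> \<rho> ` free_vars \<phi>"
      "\<And>e. sat M e \<phi>' = sat M (e \<circ> \<rho>) \<phi>"
      using rename_formula[of L \<phi> \<rho> M] \<phi>(1) by blast
    have "\<rho> i \<in> insert 0 {1..length as}" for i
      using \<phi>(2)[of i] idx by (auto simp: \<rho>_def Suc_le_eq split: sum.splits)
    then have "free_vars \<phi>' \<subseteq> insert 0 {1..length as}" using \<phi>'(2) by fast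
    moreover note \<phi>'(1)
    moreover have "sat M (e0(0 := a)) \<phi>' \<longleftrightarrow> Q k a" if "a \<in> U" for a
    proof -
      have "(e0(0 := a) \<circ> \<rho>) i = (symval (\<lambda>_. a) \<circ> s) i" for i
        using \<phi>(2)[of i] idx by (cases "s i") (auto simp: \<rho>_def e0_def Suc_le_eq)
      then have "e0(0 := a) \<circ> \<rho> = symval (\<lambda>_. a) \<circ> s" by (rule ext)
      then show ?thesis using \<phi>(3)[of "\<lambda>_. a"] that \<phi>'(3) by simp
    qed
    ultimately show ?thesis by (intro exI[of _ \<phi>'] conjI ballI)
  qed
  then obtain \<Phi> where \<Phi>: "\<And>k. is_fm L (\<Phi> k)" "\<And>k. free_vars (\<Phi> k) \<subseteq> insert 0 {1..length as}"
    "\<And>k a. a \<in> U \<Longrightarrow> sat M (e0(0 := a)) (\<Phi> k) \<longleftrightarrow> Q k a"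
    by metis
  have "\<exists>a\<in>U. \<forall>\<phi>\<in>\<Delta>. sat M (e0(0 := a)) \<phi>" if \<Delta>: "\<Delta> \<subseteq> range \<Phi>" "finite \<Delta>" for \<Delta>
  proof -
    obtain K where "finite K" "\<Delta> = \<Phi> ` K" using finite_subset_image[OF \<Delta>(2,1)] by blast
    moreover from this obtain a where "a \<in> U" "\<forall>k\<in>K. Q k a" using fin by blast
    ultimately show ?thesis by (intro bexI[of _ a]) (simp_all add: \<Phi>(3))
  qed
  moreover have "range \<Phi> \<subseteq> {\<phi>. is_fm L \<phi> \<and> free_vars \<phi> \<subseteq> insert 0 {1..length as}}"
    using \<Phi> by blast
  ultimately have "\<exists>a\<in>U. \<forall>\<phi>\<in>range \<Phi>. sat M (e0(0 := a)) \<phi>"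
    using sat[unfolded omega_saturated_def, rule_format, OF e0, of "{1..length as}" "range \<Phi>"]
    by simp
  then obtain a where "a \<in> U" "\<forall>\<phi>\<in>range \<Phi>. sat M (e0(0 := a)) \<phi>" ..
  then show ?thesis by (intro bexI[of _ a]) (simp_all add: \<Phi>(3))
qed

text \<open>
  Saturation concerns types in one variable, so the tuple is found one coordinate at a time.
\<close>

lemma unbounded_fibre:
  assumes sat: "omega_saturated L M"
  shows "finite A \<Longrightarrow> A \<subseteq> U \<Longrightarrow> dfn A (\<lambda>e. R (map e [0..<Suc n])) \<Longrightarrow>
    (\<And>k. \<exists>c\<in>tuples U n. at_least k (\<lambda>z. R (z # c))) \<Longrightarrow>
    \<exists>c\<in>tuples U n. \<forall>k. at_least k (\<lambda>z. R (z # c))"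
proof (induction n arbitrary: A R)
  case 0
  then show ?case by simp
next
  case (Suc n)
  \<comment> \<open>The rest \<open>c\<close> of the tuple may still vary with \<open>k\<close>; the
    induction hypothesis, with \<open>a\<close> as a new parameter, makes it uniform.\<close>
  define Q where "Q k a \<longleftrightarrow> (\<exists>c\<in>tuples U n. at_least k (\<lambda>z. R (z # a # c)))" for k a
  have "dfn A (\<lambda>e. R (e 0 # e (Suc n) # map (\<lambda>i. e (Suc i)) [0..<n]))"
    by (intro dfn_rel[OF Suc.prems(3)] tms_Cons tm_var tms_upt Suc.prems)
  then have "dfn A (\<lambda>e. at_least k (\<lambda>z. R (z # e n # map e [0..<n])))" for k
    by (rule dfn_at_least[OF _ Suc.prems(2)])
  then have "dfn A (\<lambda>e. Q k (e 0))" for k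
    unfolding Q_def by (intro dfn_ex_tuple) simp
  moreover have "\<exists>a\<in>U. \<forall>k\<in>K. Q k a" if K: "finite K" for K
  proof -
    obtain m where m: "\<forall>k\<in>K. k \<le> m" using K finite_nat_set_iff_bounded_le by blast
    obtain a c where "a \<in> U" "c \<in> tuples U n" "at_least m (\<lambda>z. R (z # a # c))"
      using Suc.prems(4)[of m] unfolding Bex_def tuples_Suc_iff by blast
    then show ?thesis unfolding Q_def using m at_least_antimono by blast
  qed
  ultimately obtain a where a: "a \<in> U" "\<And>k. Q k a"
    using omega_saturated_countable[OF sat Suc.prems(1,2), of Q] by blast
  define R' where "R' c = R (hd c # a # tl c)" for c
  have "dfn (insert a A) (\<lambda>e. R (e 0 # a # map (\<lambda>i. e (Suc i)) [0..<n]))"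
    using Suc.prems a(1)
    by (intro dfn_rel[OF dfn_mono[OF Suc.prems(3)]] tms_Cons tm_var tm_const tms_upt) auto
  then have "dfn (insert a A) (\<lambda>e. R' (map e [0..<Suc n]))"
    unfolding R'_def map_upt_Suc_Cons by simp
  then have "\<exists>c\<in>tuples U n. \<forall>k. at_least k (\<lambda>z. R' (z # c))"
    using Suc.prems a by (intro Suc.IH[of "insert a A"]) (auto simp: R'_def Q_def)
  then obtain c where "c \<in> tuples U n" "\<And>k. at_least k (\<lambda>z. R (z # a # c))"
    by (auto simp: R'_def)
  then show ?case using a(1) by (intro bexI[of _ "a # c"]) auto
qed

text \<open>Without a bound every \<open>k\<close> has a fibre with at least \<open>k\<close>
  points; saturation then yields a single fibre with at least \<open>k\<close> points for every
  \<open>k\<close>, which is infinite.\<close>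

lemma uniform_finiteness:
  assumes sat: "omega_saturated L M" and R: "dfn U (\<lambda>e. R (map e [0..<Suc n]))"
    and fin: "\<And>c. c \<in> tuples U n \<Longrightarrow> finite {z \<in> U. R (z # c)}"
  shows "\<exists>N. \<forall>c\<in>tuples U n. card {z \<in> U. R (z # c)} \<le> N"
proof (rule ccontr)
  assume nb: "\<not> ?thesis"
  have "\<exists>c\<in>tuples U n. at_least k (\<lambda>z. R (z # c))" for k
  proof -
    have "\<exists>c\<in>tuples U n. \<not> card {z \<in> U. R (z # c)} \<le> k"
      using nb by blast
    then obtain c where "c \<in> tuples U n" "k \<le> card {z \<in> U. R (z # c)}"
      using nat_le_linear by blast
    then show ?thesis
      unfolding at_least_def by (meson obtain_subset_with_card_n)
  qed
  moreover obtain A where "finite A" "A \<subseteq> U" "dfn A (\<lambda>e. R (map e [0..<Suc n]))"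
    using dfn_finite_parameters[OF R] by blast
  ultimately obtain c where "c \<in> tuples U n" "\<And>k. at_least k (\<lambda>z. R (z # c))"
    using unbounded_fibre[OF sat, of A R n] by blast
  then show False using fin infinite_if_at_least by blast
qed

end

section \<open>Visceral uniform structures\<close>

abbreviation near :: "('m \<times> 'm) set \<Rightarrow> 'm list \<Rightarrow> 'm list \<Rightarrow> bool" where
  "near D \<equiv> list_all2 (\<lambda>a b. (a, b) \<in> D)"

text \<open>\<open>Dset\<close> and \<open>\<psi>\<close> present the base as a definable family
  indexed by tuples, so that quantifying over entourages stays first order.
  \<open>ball_in_infinite\<close> is the interior condition of viscerality with a ball in place of
  an open set.\<close>

locale visceral_structure = fo_structure L M
  for L :: "('f, 'r) lang" and M :: "('f, 'r, 'm) struct" +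
  fixes \<B> :: "('m \<times> 'm) set set" and k :: nat
    and Dset :: "'m list \<Rightarrow> ('m \<times> 'm) set" and \<psi> :: "'m list \<Rightarrow> bool"
  assumes saturated: "omega_saturated L M"
    and base_nonempty: "\<B> \<noteq> {}"
    and base_subset: "D \<in> \<B> \<Longrightarrow> D \<subseteq> U \<times> U"
    and base_directed: "D \<in> \<B> \<Longrightarrow> D' \<in> \<B> \<Longrightarrow> \<exists>E\<in>\<B>. E \<subseteq> D \<inter> D'"
    and base_refl: "D \<in> \<B> \<Longrightarrow> x \<in> U \<Longrightarrow> (x, x) \<in> D"
    and base_sym: "D \<in> \<B> \<Longrightarrow> (x, y) \<in> D \<Longrightarrow> (y, x) \<in> D"
    and base_half: "D \<in> \<B> \<Longrightarrow> \<exists>E\<in>\<B>. E O E \<subseteq> D"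
    and base_proper: "D \<in> \<B> \<Longrightarrow> x \<in> U \<Longrightarrow> \<exists>E\<in>\<B>. E `` {x} \<subset> D `` {x}"
    and base_eq: "\<B> = {Dset b | b. b \<in> tuples U k \<and> \<psi> b}"
    and dfn_\<psi>: "dfn U (\<lambda>e. \<psi> (map e [0..<k]))"
    and dfn_Dset: "dfn U (\<lambda>e. (e k, e (Suc k)) \<in> Dset (map e [0..<k]))"
    and ball_in_infinite: "dfn U (\<lambda>e. P (e 0)) \<Longrightarrow> infinite {z \<in> U. P z} \<Longrightarrow>
      \<exists>D\<in>\<B>. \<exists>x\<in>U. \<forall>w. (x, w) \<in> D \<longrightarrow> P w"
begin

text \<open>\<open>\<psi> (b e)\<close> is not demanded, so \<open>\<delta> e\<close> may lie
  outside \<open>\<B>\<close>; the quantifiers over entourages supply that condition.\<close>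

definition entourage :: "((nat \<Rightarrow> 'm) \<Rightarrow> ('m \<times> 'm) set) \<Rightarrow> bool" where
  "entourage \<delta> \<longleftrightarrow> (\<exists>b. tms U k b \<and> \<delta> = (\<lambda>e. Dset (b e)))"

definition family :: "nat \<Rightarrow> (('m \<times> 'm) set \<Rightarrow> 'm list \<Rightarrow> bool) \<Rightarrow> bool" where
  "family n X \<longleftrightarrow> dfn U (\<lambda>e. X (Dset (map e [0..<k])) (map (\<lambda>i. e (i + k)) [0..<n]))"

text \<open>Monotone for reverse inclusion: as \<open>\<B>\<close> is directed, the sets
  \<open>X D\<close> form a directed union when \<open>D\<close> shrinks.\<close>

definition increasing :: "(('m \<times> 'm) set \<Rightarrow> 'a \<Rightarrow> bool) \<Rightarrow> bool" where
  "increasing X \<longleftrightarrow> (\<forall>D\<in>\<B>. \<forall>E\<in>\<B>. E \<subseteq> D \<longrightarrow> (\<forall>y. X D y \<longrightarrow> X E y))"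

definition has_interior :: "nat \<Rightarrow> ('m list \<Rightarrow> bool) \<Rightarrow> bool" where
  "has_interior n P \<longleftrightarrow> (\<exists>D\<in>\<B>. \<exists>x\<in>tuples U n. \<forall>y. near D x y \<longrightarrow> P y)"

definition dfn_fun :: "nat \<Rightarrow> ('m list \<Rightarrow> 'm) \<Rightarrow> bool" where
  "dfn_fun n f \<longleftrightarrow> (\<forall>c\<in>tuples U n. f c \<in> U) \<and>
     dfn U (\<lambda>e. e 0 = f (map (\<lambda>i. e (Suc i)) [0..<n]))"

section \<open>Definability of statements about entourages, boxes and functions\<close>

lemma entourage_const: "D \<in> \<B> \<Longrightarrow> entourage (\<lambda>e. D)"
  unfolding entourage_def base_eq using tms_const by blast

lemma entourage_upt: "entourage (\<lambda>e. Dset (map (\<lambda>i. e (\<sigma> i)) [0..<k]))"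
  unfolding entourage_def using tms_upt by blast

lemma dfn_mem:
  assumes "tm U x" "tm U y" "entourage \<delta>"
  shows "dfn U (\<lambda>e. (x e, y e) \<in> \<delta> e)"
proof -
  obtain ts where ts: "length ts = k" "\<forall>u\<in>set ts. tm U u" "\<delta> = (\<lambda>e. Dset (map (\<lambda>u. u e) ts))"
    using assms unfolding entourage_def tms_def by blast
  define s where "s i = (if i < k then ts ! i else if i = k then x else y)" for i
  have "tm U (s i)" for i
    using assms ts by (auto simp: s_def)
  moreover have "map (\<lambda>i. s i e) [0..<k] = map (\<lambda>u. u e) ts" for e
    using ts by (auto simp: s_def intro!: nth_equalityI)
  moreover have "s k e = x e" "s (Suc k) e = y e" for e by (simp_all add: s_def)
  ultimately show ?thesis
    using dfn_subst[OF dfn_Dset, of s] ts(3) by simp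
qed

lemma dfn_family:
  assumes "family n X" "entourage \<delta>" "tms U n t"
  shows "dfn U (\<lambda>e. X (\<delta> e) (t e))"
proof -
  obtain ts where ts: "length ts = k" "\<forall>u\<in>set ts. tm U u" "\<delta> = (\<lambda>e. Dset (map (\<lambda>u. u e) ts))"
    using assms(2) unfolding entourage_def tms_def by blast
  obtain us where us: "length us = n" "\<forall>u\<in>set us. tm U u" "t = (\<lambda>e. map (\<lambda>u. u e) us)"
    using assms(3) unfolding tms_def by blast
  define s where "s i = (if i < k then ts ! i else if i < n + k then us ! (i - k) else (\<lambda>e. e 0))" for i
  have "tm U (s i)" for i
    using us ts tm_var by (auto simp: s_def)
  moreover have "map (\<lambda>i. s i e) [0..<k] = map (\<lambda>u. u e) ts" for e
    using ts by (auto simp: s_def intro!: nth_equalityI)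
  moreover have "map (\<lambda>i. s (i + k) e) [0..<n] = t e" for e
    using us by (auto simp: s_def intro!: nth_equalityI)
  ultimately show ?thesis
    using dfn_subst[OF assms(1)[unfolded family_def], of s] ts(3) by simp
qed

lemma dfn_ex_entourage:
  assumes "dfn U (\<lambda>e. Q (\<lambda>i. e (i + k)) (Dset (map e [0..<k])))"
  shows "dfn U (\<lambda>e. \<exists>D\<in>\<B>. Q e D)"
proof -
  have "dfn U (\<lambda>e. \<exists>b\<in>tuples U k. \<psi> b \<and> Q e (Dset b))"
    using assms dfn_\<psi> by (intro dfn_ex_tuple dfn_conj)
  moreover have "(\<exists>b\<in>tuples U k. \<psi> b \<and> Q e (Dset b)) \<longleftrightarrow> (\<exists>D\<in>\<B>. Q e D)" for e
    unfolding base_eq by blast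
  ultimately show ?thesis by simp
qed

lemma dfn_all_entourage:
  "dfn U (\<lambda>e. Q (\<lambda>i. e (i + k)) (Dset (map e [0..<k]))) \<Longrightarrow> dfn U (\<lambda>e. \<forall>D\<in>\<B>. Q e D)"
  using dfn_neg[OF dfn_ex_entourage[of "\<lambda>e D. \<not> Q e D"]] dfn_neg by auto

lemma dfn_near:
  assumes "entourage \<delta>" "tms U n s" "tms U n t"
  shows "dfn U (\<lambda>e. near (\<delta> e) (s e) (t e))"
proof -
  obtain ss where ss: "length ss = n" "\<forall>u\<in>set ss. tm U u" "s = (\<lambda>e. map (\<lambda>u. u e) ss)"
    using assms(2) unfolding tms_def by blast
  obtain ts where ts: "length ts = n" "\<forall>u\<in>set ts. tm U u" "t = (\<lambda>e. map (\<lambda>u. u e) ts)"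
    using assms(3) unfolding tms_def by blast
  have "dfn U (\<lambda>e. \<forall>i\<in>{..<n}. ((ss ! i) e, (ts ! i) e) \<in> \<delta> e)"
    using ss ts by (intro dfn_fin_all dfn_mem assms(1)) auto
  moreover have "near (\<delta> e) (s e) (t e) \<longleftrightarrow> (\<forall>i\<in>{..<n}. ((ss ! i) e, (ts ! i) e) \<in> \<delta> e)" for e
    using ss ts by (auto simp: list_all2_conv_all_nth)
  ultimately show ?thesis by simp
qed

text \<open>Values of \<open>f\<close> are not terms, so they enter as two quantified elements
  \<open>a\<close> and \<open>b\<close>; the terms \<open>s\<close>, \<open>t\<close> and
  \<open>\<delta>\<close> are shifted by two places to make room for them.\<close>

lemma dfn_fun_mem:
  assumes "dfn_fun n f" "tms U n s" "tms U n t" "entourage \<delta>"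
  shows "dfn U (\<lambda>e. (f (s e), f (t e)) \<in> \<delta> e)"
proof -
  have f: "dfn U (\<lambda>e. hd (map e [0..<Suc n]) = f (tl (map e [0..<Suc n])))"
    using assms(1) unfolding dfn_fun_def map_upt_Suc_Cons by simp
  obtain ss where ss: "length ss = n" "\<forall>u\<in>set ss. tm U u" "s = (\<lambda>e. map (\<lambda>u. u e) ss)"
    using assms(2) unfolding tms_def by blast
  obtain ts where ts: "length ts = n" "\<forall>u\<in>set ts. tm U u" "t = (\<lambda>e. map (\<lambda>u. u e) ts)"
    using assms(3) unfolding tms_def by blast
  obtain b where b: "tms U k b" "\<delta> = (\<lambda>e. Dset (b e))"
    using assms(4) unfolding entourage_def by blast
  have shift: "tms U m (\<lambda>e. u (\<lambda>i. e (Suc (Suc i))))" if u: "tms U m u" for m u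
  proof -
    obtain us where us: "length us = m" "\<forall>u\<in>set us. tm U u" "u = (\<lambda>e. map (\<lambda>u. u e) us)"
      using u unfolding tms_def by blast
    have "tm U (\<lambda>e. v (\<lambda>i. e (Suc (Suc i))))" if "tm U v" for v
    proof -
      obtain s where s: "\<And>a. s = Inr a \<Longrightarrow> a \<in> U" "v = (\<lambda>e. symval e s)"
        using \<open>tm U v\<close> unfolding tm_def by blast
      show ?thesis using s by (cases s) (auto intro: tm_var tm_const)
    qed
    then show ?thesis unfolding tms_def us(3)
      using us by (intro exI[of _ "map (\<lambda>v e. v (\<lambda>i. e (Suc (Suc i)))) us"]) auto
  qed
  have "entourage (\<lambda>e. \<delta> (\<lambda>i. e (Suc (Suc i))))"
    unfolding entourage_def b(2) using shift[OF b(1)] by blast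
  moreover have "dfn U (\<lambda>e. e j = f (u (\<lambda>i. e (Suc (Suc i)))))" if "tms U n u" for j u
    using dfn_rel[OF f tms_Cons[OF tm_var[of U j] shift[OF that]]] by simp
  ultimately have "dfn U (\<lambda>e. \<exists>a\<in>U. \<exists>b\<in>U. a = f (s e) \<and> b = f (t e) \<and> (a, b) \<in> \<delta> e)"
    using assms by (intro dfn_ex dfn_conj dfn_mem tm_var)
  moreover have "(\<exists>a\<in>U. \<exists>b\<in>U. a = f (s e) \<and> b = f (t e) \<and> (a, b) \<in> \<delta> e) \<longleftrightarrow>
      (f (s e), f (t e)) \<in> \<delta> e" if "e \<in> envs" for e
  proof -
    have "s e \<in> tuples U n" "t e \<in> tuples U n"
      using ss ts tm_in[OF _ order_refl that] by (auto simp: tuples_def)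
    then show ?thesis using assms(1) unfolding dfn_fun_def by blast
  qed
  ultimately show ?thesis by (subst dfn_cong) auto
qed

lemmas dfn_intros = dfn_conj dfn_disj dfn_imp dfn_neg dfn_ex dfn_all dfn_ex_entourage
  dfn_all_entourage dfn_mem dfn_eq tm_var entourage_upt tms_Cons tms_Nil tms_upt

section \<open>Infinite balls and directed unions\<close>

text \<open>Every ball properly contains another one around the same point, so a finite ball would
  start an infinite descent of cardinalities.\<close>

lemma infinite_ball:
  assumes "D \<in> \<B>" "x \<in> U"
  shows "infinite (D `` {x})"
proof
  assume "finite (D `` {x})"
  then show False using assms(1)
  proof (induction "card (D `` {x})" arbitrary: D rule: less_induct)
    case less
    obtain E where E: "E \<in> \<B>" "E `` {x} \<subset> D `` {x}"
      using base_proper[OF less.prems(2) assms(2)] by blast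
    show False
      using less.hyps[of E] E psubset_card_mono[OF less.prems(1) E(2)] finite_subset[OF _ less.prems(1)]
      by blast
  qed
qed

lemma base_lower_bound:
  "finite F \<Longrightarrow> F \<subseteq> \<B> \<Longrightarrow> \<exists>E\<in>\<B>. \<forall>D\<in>F. E \<subseteq> D"
proof (induction F rule: finite_induct)
  case empty
  then show ?case using base_nonempty by blast
next
  case (insert D F)
  then obtain E where "E \<in> \<B>" "\<forall>D\<in>F. E \<subseteq> D" by blast
  moreover obtain E' where "E' \<in> \<B>" "E' \<subseteq> E \<inter> D"
    using base_directed insert.prems \<open>E \<in> \<B>\<close> by (metis insert_subset)
  ultimately show ?case by blast
qed

text \<open>Were all members finite, their sizes would have a common bound \<open>N\<close>; but any
  \<open>N + 1\<close> points of the union lie in a single member, by directedness.\<close>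

lemma infinite_directed_union:
  assumes X: "dfn U (\<lambda>e. X (Dset (map e [0..<k])) (e k))" "increasing X"
    and inf: "infinite {z \<in> U. \<exists>D\<in>\<B>. X D z}"
  shows "\<exists>D\<in>\<B>. infinite {z \<in> U. X D z}"
proof (rule ccontr)
  assume fin: "\<not> ?thesis"
  \<comment> \<open>The conjunct \<open>\<psi>\<close> empties the fibres over tuples that code no
    entourage, as the uniform bound asks for finite fibres over all tuples.\<close>
  define R where "R l \<longleftrightarrow> \<psi> (tl l) \<and> X (Dset (tl l)) (hd l)" for l
  define s where "s i = (if i < k then (\<lambda>e. e (Suc i)) else (\<lambda>e :: nat \<Rightarrow> 'm. e 0))" for i
  have s: "tm U (s i)" for i by (simp add: s_def tm_var)
  have "map (\<lambda>i. s i e) [0..<k] = map (\<lambda>i. e (Suc i)) [0..<k]" "s k e = e 0" for e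
    by (simp_all add: s_def)
  then have "dfn U (\<lambda>e. X (Dset (map (\<lambda>i. e (Suc i)) [0..<k])) (e 0))"
    using dfn_subst[OF X(1), of s, OF s order_refl] by (simp only:)
  then have "dfn U (\<lambda>e. R (map e [0..<Suc k]))"
    unfolding R_def map_upt_Suc_Cons list.sel
    by (intro dfn_conj dfn_rel[OF dfn_\<psi>] tms_upt order_refl)
  moreover have "finite {z \<in> U. R (z # b)}" if "b \<in> tuples U k" for b
    using fin that unfolding R_def base_eq list.sel by (cases "\<psi> b") auto
  ultimately obtain N where N: "\<And>b. b \<in> tuples U k \<Longrightarrow> card {z \<in> U. R (z # b)} \<le> N"
    using uniform_finiteness[OF saturated, of R k] by blast
  obtain F where F: "F \<subseteq> {z \<in> U. \<exists>D\<in>\<B>. X D z}" "finite F" "card F = Suc N"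
    using infinite_arbitrarily_large[OF inf] by blast
  have "\<forall>z\<in>F. \<exists>D. D \<in> \<B> \<and> X D z" using F(1) by blast
  then obtain \<Delta> where \<Delta>: "\<And>z. z \<in> F \<Longrightarrow> \<Delta> z \<in> \<B> \<and> X (\<Delta> z) z"
    using bchoice[of F "\<lambda>z D. D \<in> \<B> \<and> X D z"] by blast
  have "finite (\<Delta> ` F)" "\<Delta> ` F \<subseteq> \<B>" using F(2) \<Delta> by auto
  then obtain E where "E \<in> \<B>" "\<forall>D\<in>\<Delta> ` F. E \<subseteq> D"
    using base_lower_bound by meson
  then have E: "E \<in> \<B>" "\<And>z. z \<in> F \<Longrightarrow> E \<subseteq> \<Delta> z" by simp_all
  from E(1) obtain b where b: "b \<in> tuples U k" "\<psi> b" "E = Dset b" unfolding base_eq by blast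
  have "X E z" if "z \<in> F" for z
    using X(2) \<Delta>[OF that] E(1) E(2)[OF that] unfolding increasing_def by blast
  then have "F \<subseteq> {z \<in> U. R (z # b)}"
    using F(1) b unfolding R_def by auto
  moreover have "finite {z \<in> U. X E z}" using fin E(1) by blast
  then have "finite {z \<in> U. R (z # b)}"
    by (rule rev_finite_subset) (auto simp: R_def b(3))
  ultimately have "card F \<le> card {z \<in> U. R (z # b)}" by (simp only: card_mono)
  then show False using N[OF b(1)] F(3) by linarith
qed

lemma near_tuples: "D \<in> \<B> \<Longrightarrow> near D x y \<Longrightarrow> length x = n \<Longrightarrow> y \<in> tuples U n"
  using base_subset by (fastforce simp: tuples_def list_all2_conv_all_nth in_set_conv_nth)

lemma near_mono: "near E x y \<Longrightarrow> E \<subseteq> D \<Longrightarrow> near D x y"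
  by (auto elim: list_all2_mono)

lemma near_refl: "D \<in> \<B> \<Longrightarrow> x \<in> tuples U n \<Longrightarrow> near D x x"
  by (auto simp: tuples_def intro!: list.rel_refl_strong base_refl)

text \<open>
  The exceptional sets of points \<open>z\<close> are uniformly finite in \<open>c\<close>, so any sufficiently large finite
  set contains a good point for each \<open>c\<close>, and one of these points is good for many \<open>c\<close>.
\<close>

lemma common_good_point:
  assumes directed: "\<And>\<Y>. finite \<Y> \<Longrightarrow> (\<And>Y. Y \<in> \<Y> \<Longrightarrow> family n Y \<and> increasing Y) \<Longrightarrow>
      has_interior n (\<lambda>c. \<exists>Y\<in>\<Y>. \<exists>E\<in>\<B>. Y E c) \<Longrightarrow> \<exists>Y\<in>\<Y>. \<exists>E\<in>\<B>. has_interior n (Y E)"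
    and \<X>: "finite \<X>" "\<And>X. X \<in> \<X> \<Longrightarrow> family (Suc n) X \<and> increasing X"
    and D0: "D0 \<in> \<B>" "x0 \<in> U" "c0 \<in> tuples U n"
    and fin: "\<And>c. near D0 c0 c \<Longrightarrow>
      finite {z \<in> U. (x0, z) \<in> D0 \<and> \<not> (\<exists>X\<in>\<X>. \<exists>E\<in>\<B>. X E (z # c))}"
  shows "\<exists>z\<in>U. \<exists>X\<in>\<X>. \<exists>E\<in>\<B>. has_interior n (\<lambda>c. X E (z # c))"
proof -
  \<comment> \<open>Outside the box around \<open>c0\<close> nothing is known about exceptional
    points; the first conjunct makes those fibres empty.\<close>
  define R where "R l \<longleftrightarrow> near D0 c0 (tl l) \<and> (x0, hd l) \<in> D0 \<and>
      \<not> (\<exists>X\<in>\<X>. \<exists>E\<in>\<B>. X E (hd l # tl l))" for l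
  have "dfn U (\<lambda>e. R (map e [0..<Suc n]))"
    unfolding R_def map_upt_Suc_Cons list.sel
    using D0 \<X> by (intro dfn_intros dfn_near[of _ n] dfn_fin_ex dfn_family[of "Suc n"] entourage_const tms_const tm_const)
      (auto intro: tms_upt)
  moreover have "finite {z \<in> U. R (z # c)}" if "c \<in> tuples U n" for c
    using fin[of c] unfolding R_def list.sel by (cases "near D0 c0 c") auto
  ultimately obtain N where N: "\<And>c. c \<in> tuples U n \<Longrightarrow> card {z \<in> U. R (z # c)} \<le> N"
    using uniform_finiteness[OF saturated, of R n] by blast
  obtain F where F: "F \<subseteq> D0 `` {x0}" "finite F" "card F = Suc N"
    using infinite_arbitrarily_large[OF infinite_ball[OF D0(1,2)]] by blast
  have FU: "F \<subseteq> U" using F(1) base_subset[OF D0(1)] by blast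
  \<comment> \<open>With \<open>z\<close> frozen, each pair of a family and a point of
    \<open>F\<close> becomes a family in the remaining \<open>n\<close> coordinates; together they
    cover the box around \<open>c0\<close>.\<close>
  define \<Y> where "\<Y> = (\<lambda>(X, z) E c. X E (z # c)) ` (\<X> \<times> F)"
  have "finite \<Y>" using \<X>(1) F(2) by (simp add: \<Y>_def)
  moreover have "family n Y \<and> increasing Y" if Y: "Y \<in> \<Y>" for Y
  proof -
    obtain X z where X: "X \<in> \<X>" "z \<in> F" "Y = (\<lambda>E c. X E (z # c))"
      using Y unfolding \<Y>_def by auto
    have "family n Y" unfolding X(3) family_def[of n]
      using \<X>(2)[OF X(1)] X(2) FU
      by (intro dfn_family[of "Suc n"] dfn_intros entourage_upt[of "\<lambda>i. i"] tm_const) auto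
    moreover have "increasing Y"
      using \<X>(2)[OF X(1)] unfolding increasing_def X(3) by blast
    ultimately show ?thesis ..
  qed
  moreover have "has_interior n (\<lambda>c. \<exists>Y\<in>\<Y>. \<exists>E\<in>\<B>. Y E c)"
    unfolding has_interior_def
  proof (intro bexI[of _ D0] bexI[of _ c0] D0 allI impI)
    fix c assume c: "near D0 c0 c"
    then have cU: "c \<in> tuples U n" using near_tuples D0 unfolding tuples_def by blast
    have "finite {z \<in> U. R (z # c)}"
      using fin[OF c] c unfolding R_def list.sel by simp
    then have "F \<subseteq> {z \<in> U. R (z # c)} \<Longrightarrow> Suc N \<le> card {z \<in> U. R (z # c)}"
      using card_mono F(3) by metis
    then have "\<not> F \<subseteq> {z \<in> U. R (z # c)}"
      using N[OF cU] by linarith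
    then obtain z where z: "z \<in> F" "\<not> R (z # c)" using FU by blast
    then have "(x0, z) \<in> D0" using F(1) by blast
    with z(2) c have "\<exists>X\<in>\<X>. \<exists>E\<in>\<B>. X E (z # c)" unfolding R_def list.sel by simp
    then obtain X E where "X \<in> \<X>" "E \<in> \<B>" "X E (z # c)" by blast
    moreover have "(\<lambda>E c. X E (z # c)) \<in> \<Y>"
      unfolding \<Y>_def using \<open>X \<in> \<X>\<close> \<open>z \<in> F\<close> by (intro image_eqI[of _ _ "(X, z)"]) auto
    ultimately show "\<exists>Y\<in>\<Y>. \<exists>E\<in>\<B>. Y E c"
      by (intro bexI[of _ "\<lambda>E c. X E (z # c)"] bexI[of _ E])
  qed
  \<comment> \<open>\<open>directed\<close> is a hypothesis because this argument also runs inside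
    the induction that proves it.\<close>
  ultimately have "\<exists>Y\<in>\<Y>. \<exists>E\<in>\<B>. has_interior n (Y E)" by (rule directed)
  then show ?thesis using FU unfolding \<Y>_def by auto
qed

text \<open>Induction on the number of coordinates. Fixing the first coordinate leaves finitely many
  candidates for it, each giving its own families in the others; hence a finite set
  \<open>\<X>\<close> instead of one family.\<close>

lemma directed_union_interior:
  "finite \<X> \<Longrightarrow> (\<And>X. X \<in> \<X> \<Longrightarrow> family n X \<and> increasing X) \<Longrightarrow>
     has_interior n (\<lambda>y. \<exists>X\<in>\<X>. \<exists>D\<in>\<B>. X D y) \<Longrightarrow> \<exists>X\<in>\<X>. \<exists>D\<in>\<B>. has_interior n (X D)"
proof (induction n arbitrary: \<X>)
  case 0
  then show ?case unfolding has_interior_def by auto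
next
  case (Suc n)
  obtain D0 x0 c0 where D0: "D0 \<in> \<B>" "x0 \<in> U" "c0 \<in> tuples U n"
    "\<And>z c. (x0, z) \<in> D0 \<Longrightarrow> near D0 c0 c \<Longrightarrow> \<exists>X\<in>\<X>. \<exists>D\<in>\<B>. X D (z # c)"
    using Suc.prems(3) unfolding has_interior_def Bex_def tuples_Suc_iff
    by (metis list_all2_Cons)
  \<comment> \<open>Asking for \<open>X E\<close> on a whole ball in the first coordinate lets an
    interior found in the other coordinates, at one fixed \<open>z\<close>, spread to a box in all
    of them.\<close>
  define lift where "lift X E y \<longleftrightarrow> (\<forall>w\<in>U. (hd y, w) \<in> E \<longrightarrow> X E (w # tl y))"
    for X :: "('m \<times> 'm) set \<Rightarrow> 'm list \<Rightarrow> bool" and E y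
  have lift: "family (Suc n) (lift X) \<and> increasing (lift X)" if "X \<in> \<X>" for X
  proof -
    have X: "family (Suc n) X" "increasing X" using Suc.prems(2) that by auto
    have "family (Suc n) (lift X)"
      unfolding family_def[of "Suc n" "lift X"] lift_def map_upt_Suc_Cons list.sel
      by (intro dfn_intros dfn_family[OF X(1)] entourage_upt[of Suc])
    moreover have "increasing (lift X)"
      using X(2) unfolding increasing_def lift_def by (metis subsetD)
    ultimately show ?thesis ..
  qed
  have "finite {z \<in> U. (x0, z) \<in> D0 \<and> \<not> (\<exists>X\<in>lift ` \<X>. \<exists>E\<in>\<B>. X E (z # c))}"
    if c: "near D0 c0 c" for c
  proof (rule ccontr)
    have cU: "c \<in> tuples U n" using near_tuples D0 c unfolding tuples_def by blast
    have "dfn U (\<lambda>e. (x0, e 0) \<in> D0 \<and> \<not> (\<exists>X\<in>lift ` \<X>. \<exists>E\<in>\<B>. X E (e 0 # c)))"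
      using D0 lift Suc.prems(1) cU
      by (intro dfn_intros dfn_fin_ex dfn_family[of "Suc n"] entourage_const tm_const tms_const) auto
    moreover assume "infinite {z \<in> U. (x0, z) \<in> D0 \<and> \<not> (\<exists>X\<in>lift ` \<X>. \<exists>E\<in>\<B>. X E (z # c))}"
    ultimately obtain D1 x1 where D1: "D1 \<in> \<B>" "x1 \<in> U"
      "\<And>z. (x1, z) \<in> D1 \<Longrightarrow> (x0, z) \<in> D0 \<and> \<not> (\<exists>X\<in>lift ` \<X>. \<exists>E\<in>\<B>. X E (z # c))"
      using ball_in_infinite[of "\<lambda>z. (x0, z) \<in> D0 \<and> \<not> (\<exists>X\<in>lift ` \<X>. \<exists>E\<in>\<B>. X E (z # c))"] by blast
    \<comment> \<open>A ball of exceptional points is still covered by the sets \<open>X D\<close>.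
      Finiteness of \<open>\<X>\<close> and directedness put infinitely many of its points into one
      \<open>X D\<close>, which therefore contains a ball.\<close>
    have "D1 `` {x1} \<subseteq> (\<Union>X\<in>\<X>. {z \<in> U. \<exists>D\<in>\<B>. (x1, z) \<in> D1 \<and> X D (z # c)})"
    proof
      fix z assume "z \<in> D1 `` {x1}"
      then have z: "(x1, z) \<in> D1" "z \<in> U" using base_subset[OF D1(1)] by blast+
      moreover obtain X D where "X \<in> \<X>" "D \<in> \<B>" "X D (z # c)"
        using D0(4)[OF _ c, of z] D1(3) z by blast
      ultimately show "z \<in> (\<Union>X\<in>\<X>. {z \<in> U. \<exists>D\<in>\<B>. (x1, z) \<in> D1 \<and> X D (z # c)})" by blast
    qed
    then have "\<not> (\<forall>X\<in>\<X>. finite {z \<in> U. \<exists>D\<in>\<B>. (x1, z) \<in> D1 \<and> X D (z # c)})"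
      using infinite_ball[OF D1(1,2)] Suc.prems(1) finite_subset by blast
    then obtain X where X: "X \<in> \<X>" "infinite {z \<in> U. \<exists>D\<in>\<B>. (x1, z) \<in> D1 \<and> X D (z # c)}" by blast
    have famX: "family (Suc n) X" "increasing X" using Suc.prems(2) X(1) by auto
    have "dfn U (\<lambda>e. (x1, e k) \<in> D1 \<and> X (Dset (map e [0..<k])) (e k # c))"
      using D1 cU
      by (intro dfn_intros dfn_family[OF famX(1)] entourage_const entourage_upt[of "\<lambda>i. i"] tm_const tms_const)
    moreover have "increasing (\<lambda>D z. (x1, z) \<in> D1 \<and> X D (z # c))"
      using famX(2) unfolding increasing_def by blast
    ultimately obtain D where D: "D \<in> \<B>" "infinite {z \<in> U. (x1, z) \<in> D1 \<and> X D (z # c)}"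
      using infinite_directed_union[of "\<lambda>D z. (x1, z) \<in> D1 \<and> X D (z # c)"] X(2) by blast
    have "dfn U (\<lambda>e. (x1, e 0) \<in> D1 \<and> X D (e 0 # c))"
      using D1 D(1) cU
      by (intro dfn_intros dfn_family[OF famX(1)] entourage_const tm_const tms_const)
    then obtain D2 x2 where D2: "D2 \<in> \<B>" "x2 \<in> U"
      "\<And>w. (x2, w) \<in> D2 \<Longrightarrow> (x1, w) \<in> D1 \<and> X D (w # c)"
      using ball_in_infinite[of "\<lambda>z. (x1, z) \<in> D1 \<and> X D (z # c)"] D(2) by blast
    \<comment> \<open>Inside \<open>D2\<close> the ball around \<open>x2\<close> stays in
      \<open>X D\<close>, and inside \<open>D\<close> the set \<open>X D\<close> passes to
      \<open>X E\<close>; so \<open>x2\<close> is not exceptional.\<close>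
    obtain E where E: "E \<in> \<B>" "E \<subseteq> D \<inter> D2" using base_directed D(1) D2(1) by blast
    have "lift X E (x2 # c)"
      using D2(3) E famX(2) D(1) unfolding lift_def increasing_def list.sel by blast
    moreover have "(x1, x2) \<in> D1" using D2 base_refl by blast
    ultimately show False using D1(3) X(1) E(1) by blast
  qed
  then obtain z X E where z: "z \<in> U" "X \<in> \<X>" "E \<in> \<B>" "has_interior n (\<lambda>c. lift X E (z # c))"
    using common_good_point[of n "lift ` \<X>" D0 x0 c0] Suc.IH Suc.prems(1) lift D0(1-3) by blast
  then obtain D' c' where D': "D' \<in> \<B>" "c' \<in> tuples U n" "\<And>c. near D' c' c \<Longrightarrow> lift X E (z # c)"
    unfolding has_interior_def by blast
  \<comment> \<open>\<open>D'\<close> keeps the other coordinates where \<open>lift\<close> holds,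
    \<open>E\<close> keeps the first one in the ball that \<open>lift\<close> covers.\<close>
  obtain E' where E': "E' \<in> \<B>" "E' \<subseteq> D' \<inter> E" using base_directed D'(1) z(3) by blast
  have "X E y" if near: "near E' (z # c') y" for y
  proof -
    obtain w c where y: "y = w # c" "(z, w) \<in> E'" "near E' c' c"
      using near by (auto simp: list_all2_Cons1)
    then have "lift X E (z # c)" using D'(3) E'(2) near_mono by blast
    then show ?thesis using y E' z(3) base_subset unfolding lift_def list.sel by blast
  qed
  then have "has_interior (Suc n) (X E)"
    unfolding has_interior_def using E'(1) z(1) D'(2)
    by (intro bexI[of _ E'] bexI[of _ "z # c'"]) auto
  then show ?case using z by blast
qed

section \<open>Small oscillation on a box\<close>

text \<open>If \<open>g\<close> takes finitely many values on \<open>P\<close>, it is constant on an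
  infinite set. Otherwise its image contains a ball, and the part of \<open>P\<close> sent into a
  small ball with the same centre is infinite since it maps onto that ball. Either infinite set
  contains a ball.\<close>

lemma small_oscillation_1:
  assumes g: "\<And>w. w \<in> U \<Longrightarrow> g w \<in> U" "dfn U (\<lambda>e. e 0 = g (e 1))"
    and D: "D \<in> \<B>" and P: "dfn U (\<lambda>e. P (e 0))" "infinite {z \<in> U. P z}"
  shows "\<exists>E\<in>\<B>. \<exists>x\<in>U. (\<forall>w. (x, w) \<in> E \<longrightarrow> P w) \<and>
    (\<forall>w w'. (x, w) \<in> E \<longrightarrow> (x, w') \<in> E \<longrightarrow> (g w, g w') \<in> D)"
proof -
  have g': "dfn U (\<lambda>e. u e = g (v e))" if "tm U u" "tm U v" for u v
    using dfn_subst[OF g(2), of "\<lambda>i. if i = 0 then u else v"] that by simp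
  have "\<exists>Q. dfn U (\<lambda>e. Q (e 0)) \<and> infinite {z \<in> U. Q z} \<and> (\<forall>w. Q w \<longrightarrow> P w) \<and>
      (\<forall>w w'. Q w \<longrightarrow> Q w' \<longrightarrow> (g w, g w') \<in> D)"
  proof (cases "finite (g ` {z \<in> U. P z})")
    case True
    then obtain a where a: "a \<in> {z \<in> U. P z}" "infinite {z \<in> {z \<in> U. P z}. g z = g a}"
      using pigeonhole_infinite[OF P(2)] by blast
    have "dfn U (\<lambda>e. P (e 0) \<and> g a = g (e 0))"
      using a g(1) by (intro dfn_conj P g' tm_var tm_const) auto
    moreover have "{z \<in> U. P z \<and> g a = g z} = {z \<in> {z \<in> U. P z}. g z = g a}" by auto
    moreover have "(g a, g a) \<in> D" using a D g(1) base_refl by auto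
    then have "(g w, g w') \<in> D" if "g a = g w" "g a = g w'" for w w'
      using that by simp
    ultimately show ?thesis
      using a(2) by (intro exI[of _ "\<lambda>z. P z \<and> g a = g z"]) simp
  next
    case False
    have "dfn U (\<lambda>e. \<exists>w\<in>U. P w \<and> e 0 = g w)"
      by (intro dfn_ex dfn_conj dfn_tm[OF P(1)] g' tm_var order_refl)
    moreover have "{v \<in> U. \<exists>w\<in>U. P w \<and> v = g w} = g ` {z \<in> U. P z}" using g(1) by auto
    ultimately obtain D' d where D': "D' \<in> \<B>" "d \<in> U" "\<And>v. (d, v) \<in> D' \<Longrightarrow> \<exists>w\<in>U. P w \<and> v = g w"
      using ball_in_infinite[of "\<lambda>v. \<exists>w\<in>U. P w \<and> v = g w"] False by auto
    \<comment> \<open>Two values in the \<open>E\<close>-ball of \<open>d\<close> are joined through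
      \<open>d\<close> by two \<open>E\<close>-steps, hence are \<open>D\<close>-close.\<close>
    obtain E where E: "E \<in> \<B>" "E O E \<subseteq> D" using base_half D by blast
    obtain D'' where D'': "D'' \<in> \<B>" "D'' \<subseteq> D' \<inter> E" using base_directed E(1) D'(1) by blast
    have "dfn U (\<lambda>e. \<exists>v\<in>U. v = g (e 0) \<and> P (e 0) \<and> (d, v) \<in> D'')"
      by (intro dfn_intros g' dfn_tm[OF P(1)] tm_const entourage_const D'' D'(2) order_refl)
    then have "dfn U (\<lambda>e. P (e 0) \<and> (d, g (e 0)) \<in> D'')"
      by (rule iffD1[OF dfn_cong, rotated]) (use g(1) in auto)
    moreover have "D'' `` {d} \<subseteq> g ` {z \<in> U. P z \<and> (d, g z) \<in> D''}"
      using D'(3) D''(2) by blast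
    then have "infinite {z \<in> U. P z \<and> (d, g z) \<in> D''}"
      using infinite_ball[OF D''(1) D'(2)] finite_surj by blast
    moreover have "(g w, g w') \<in> D" if "(d, g w) \<in> D''" "(d, g w') \<in> D''" for w w'
      using that D''(2) E base_sym by blast
    ultimately show ?thesis by (intro exI[of _ "\<lambda>z. P z \<and> (d, g z) \<in> D''"]) auto
  qed
  then obtain Q where Q: "dfn U (\<lambda>e. Q (e 0))" "infinite {z \<in> U. Q z}" "\<forall>w. Q w \<longrightarrow> P w"
    "\<forall>w w'. Q w \<longrightarrow> Q w' \<longrightarrow> (g w, g w') \<in> D" by blast
  then show ?thesis using ball_in_infinite[OF Q(1,2)] by meson
qed

text \<open>The coordinates are controlled separately: the first one near a fixed \<open>z\<close>,
  with an entourage common to many \<open>c\<close>, and the others by the induction hypothesis for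
  \<open>f (z # c)\<close> as a function of \<open>c\<close>.\<close>

lemma small_oscillation:
  "dfn_fun n f \<Longrightarrow> dfn U (\<lambda>e. P (map e [0..<n])) \<Longrightarrow> has_interior n P \<Longrightarrow> D \<in> \<B> \<Longrightarrow>
    \<exists>E\<in>\<B>. \<exists>x\<in>tuples U n. (\<forall>y. near E x y \<longrightarrow> P y) \<and>
      (\<forall>y y'. near E x y \<longrightarrow> near E x y' \<longrightarrow> (f y, f y') \<in> D)"
proof (induction n arbitrary: f P D)
  case 0
  then show ?case using base_refl unfolding has_interior_def dfn_fun_def by auto
next
  case (Suc n)
  have fU: "f y \<in> U" if "y \<in> tuples U (Suc n)" for y
    using Suc.prems(1) that unfolding dfn_fun_def by blast
  \<comment> \<open>The final comparison takes three steps of size \<open>D2\<close>, which fit into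
    \<open>D1 O D1\<close>.\<close>
  obtain D1 where D1: "D1 \<in> \<B>" "D1 O D1 \<subseteq> D" using base_half Suc.prems(4) by blast
  obtain D2 where D2: "D2 \<in> \<B>" "D2 O D2 \<subseteq> D1" using base_half D1(1) by blast
  obtain D0 x0 c0 where D0: "D0 \<in> \<B>" "x0 \<in> U" "c0 \<in> tuples U n"
    "\<And>z c. (x0, z) \<in> D0 \<Longrightarrow> near D0 c0 c \<Longrightarrow> P (z # c)"
    using Suc.prems(3) unfolding has_interior_def Bex_def tuples_Suc_iff
    by (metis list_all2_Cons)
  define X where "X E y \<longleftrightarrow> (\<forall>w\<in>U. (hd y, w) \<in> E \<longrightarrow> P (w # tl y) \<and>
      (\<forall>w'\<in>U. (hd y, w') \<in> E \<longrightarrow> (f (w # tl y), f (w' # tl y)) \<in> D2))" for E y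
  have famX: "family (Suc n) X"
    unfolding family_def X_def map_upt_Suc_Cons list.sel
    by (intro dfn_intros dfn_fun_mem[OF Suc.prems(1)] dfn_rel[OF Suc.prems(2)] entourage_upt[of Suc]
        entourage_const D2 order_refl entourage_upt[of "\<lambda>i. Suc (Suc i)"])
  moreover have "increasing X"
    unfolding increasing_def X_def by (meson subsetD)
  moreover have "finite {z \<in> U. (x0, z) \<in> D0 \<and> \<not> (\<exists>E\<in>\<B>. X E (z # c))}"
    if c: "near D0 c0 c" for c
  proof (rule ccontr)
    have cU: "c \<in> tuples U n" using near_tuples D0 c unfolding tuples_def by blast
    have "dfn U (\<lambda>e. hd (map e [0..<Suc (Suc n)]) = f (tl (map e [0..<Suc (Suc n)])))"
      using Suc.prems(1) unfolding dfn_fun_def map_upt_Suc_Cons[of _ "Suc n"] by simp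
    moreover have "tms U (Suc (Suc n)) (\<lambda>e. e 0 # e 1 # c)"
      by (intro tms_Cons tm_var tms_const cU)
    ultimately have "dfn U (\<lambda>e. hd (e 0 # e 1 # c) = f (tl (e 0 # e 1 # c)))"
      by (rule dfn_rel) simp
    then have "dfn U (\<lambda>e. e 0 = f (e 1 # c))" by simp
    moreover have "f (w # c) \<in> U" if "w \<in> U" for w using fU cU that by simp
    moreover have "dfn U (\<lambda>e. (x0, e 0) \<in> D0 \<and> \<not> (\<exists>E\<in>\<B>. X E (e 0 # c)))"
      using D0 cU
      by (intro dfn_intros dfn_family[OF famX] entourage_const tm_const tms_const) auto
    moreover assume "infinite {z \<in> U. (x0, z) \<in> D0 \<and> \<not> (\<exists>E\<in>\<B>. X E (z # c))}"
    ultimately obtain E x where E: "E \<in> \<B>" "x \<in> U"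
      "\<And>w. (x, w) \<in> E \<Longrightarrow> (x0, w) \<in> D0 \<and> \<not> (\<exists>E\<in>\<B>. X E (w # c))"
      "\<And>w w'. (x, w) \<in> E \<Longrightarrow> (x, w') \<in> E \<Longrightarrow> (f (w # c), f (w' # c)) \<in> D2"
      using small_oscillation_1[of "\<lambda>w. f (w # c)" D2 "\<lambda>z. (x0, z) \<in> D0 \<and> \<not> (\<exists>E\<in>\<B>. X E (z # c))"]
        D2(1) by blast
    \<comment> \<open>The ball of small oscillation consists of exceptional points, yet the ball
      itself shows its centre \<open>x\<close> to be good.\<close>
    have "X E (x # c)"
      unfolding X_def list.sel using E(3,4) D0(4) c by blast
    then show False using E base_refl by blast
  qed
  ultimately obtain z E where z: "z \<in> U" "E \<in> \<B>" "has_interior n (\<lambda>c. X E (z # c))"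
    using common_good_point[of n "{X}" D0 x0 c0] directed_union_interior[of _ n] D0(1-3) by auto
  have "dfn_fun n (\<lambda>c. f (z # c))"
  proof -
    have "dfn U (\<lambda>e. hd (map e [0..<Suc (Suc n)]) = f (tl (map e [0..<Suc (Suc n)])))"
      using Suc.prems(1) unfolding dfn_fun_def map_upt_Suc_Cons[of _ "Suc n"] by simp
    moreover have "tms U (Suc (Suc n)) (\<lambda>e. e 0 # z # map (\<lambda>i. e (Suc i)) [0..<n])"
      by (intro tms_Cons tm_var tms_upt tm_const z)
    ultimately have "dfn U (\<lambda>e. hd (e 0 # z # map (\<lambda>i. e (Suc i)) [0..<n]) =
        f (tl (e 0 # z # map (\<lambda>i. e (Suc i)) [0..<n])))"
      by (rule dfn_rel) simp
    then have "dfn U (\<lambda>e. e 0 = f (z # map (\<lambda>i. e (Suc i)) [0..<n]))" by simp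
    then show ?thesis using fU z(1) unfolding dfn_fun_def by auto
  qed
  moreover have "dfn U (\<lambda>e. X E (z # map e [0..<n]))"
    using z by (intro dfn_family[OF famX] entourage_const dfn_intros tm_const tms_upt[of _ _ "\<lambda>i. i"])
  \<comment> \<open>With \<open>X E (z # c)\<close> in the role of \<open>P\<close>, both controls
    hold on the same box.\<close>
  ultimately obtain D' c' where D': "D' \<in> \<B>" "c' \<in> tuples U n"
    "\<And>c. near D' c' c \<Longrightarrow> X E (z # c)"
    "\<And>c d. near D' c' c \<Longrightarrow> near D' c' d \<Longrightarrow> (f (z # c), f (z # d)) \<in> D2"
    using Suc.IH[of "\<lambda>c. f (z # c)" "\<lambda>c. X E (z # c)" D2] z(3) D2(1) by blast
  obtain E' where E': "E' \<in> \<B>" "E' \<subseteq> D' \<inter> E" using base_directed D'(1) z(2) by blast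
  have zz: "(z, z) \<in> E" using base_refl z by blast
  have box: "\<exists>w c. y = w # c \<and> w \<in> U \<and> (z, w) \<in> E \<and> near D' c' c \<and> X E (z # c)"
    if near: "near E' (z # c') y" for y
  proof -
    obtain w c where y: "y = w # c" "(z, w) \<in> E'" "near E' c' c"
      using near by (auto simp: list_all2_Cons1)
    then have "near D' c' c" using E'(2) near_mono by blast
    then show ?thesis using y E' D'(3) base_subset by blast
  qed
  have "P y" if "near E' (z # c') y" for y
    using box[OF that] unfolding X_def list.sel by blast
  moreover have "(f y, f y') \<in> D" if yy: "near E' (z # c') y" "near E' (z # c') y'" for y y'
  proof -
    obtain w c where y: "y = w # c" "w \<in> U" "(z, w) \<in> E" "near D' c' c" "X E (z # c)"
      using box[OF yy(1)] by blast
    obtain w' d where y': "y' = w' # d" "w' \<in> U" "(z, w') \<in> E" "near D' c' d" "X E (z # d)"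
      using box[OF yy(2)] by blast
    \<comment> \<open>The change from \<open>c\<close> to \<open>d\<close> is controlled only at
      \<open>z\<close>, so the path from \<open>w # c\<close> to \<open>w' # d\<close> runs through
      \<open>z # c\<close> and \<open>z # d\<close>.\<close>
    have "(f (w # c), f (z # c)) \<in> D2" "(f (z # d), f (w' # d)) \<in> D2"
      using y y' z(1) zz unfolding X_def list.sel by blast+
    moreover have "(f (z # c), f (z # d)) \<in> D2" using D'(4) y y' by blast
    \<comment> \<open>Two of the three steps compose into \<open>D1\<close>; reflexivity of
      \<open>D2\<close> makes the remaining one a \<open>D1\<close>-step as well.\<close>
    moreover have "D2 \<subseteq> D1"
    proof
      fix p assume "p \<in> D2"
      then show "p \<in> D1" using D2 base_refl[OF D2(1)] base_subset[OF D2(1)] by (cases p) blast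
    qed
    ultimately show ?thesis unfolding y(1) y'(1) using D1(2) D2(2) by blast
  qed
  ultimately show ?case
    using E'(1) z(1) D'(2) by (intro bexI[of _ E'] bexI[of _ "z # c'"]) auto
qed

section \<open>Generic continuity\<close>

definition continuity_point :: "nat \<Rightarrow> ('m list \<Rightarrow> 'm) \<Rightarrow> 'm list \<Rightarrow> bool" where
  "continuity_point n f y \<longleftrightarrow>
     (\<forall>D\<in>\<B>. \<exists>E\<in>\<B>. \<forall>y'\<in>tuples U n. near E y y' \<longrightarrow> (f y, f y') \<in> D)"

lemma dfn_continuity_point:
  assumes "dfn_fun n f"
  shows "dfn U (\<lambda>e. continuity_point n f (map e [0..<n]))"
  unfolding continuity_point_def
  by (intro dfn_fun_mem[OF assms] dfn_near[of _ n] dfn_all_tuple dfn_intros)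

text \<open>Each point of \<open>P\<close> is a continuity point or fails at some entourage, so one
  member of these two families has interior. It cannot consist of failures: a box of small
  oscillation inside it refutes the failure at its own centre.\<close>

lemma continuity_points_interior:
  assumes f: "dfn_fun n f" and P: "dfn U (\<lambda>e. P (map e [0..<n]))" "has_interior n P"
  shows "has_interior n (\<lambda>y. P y \<and> continuity_point n f y)"
proof -
  \<comment> \<open>The entourage is a dummy argument that turns the continuity points into a
    constant increasing family.\<close>
  define good where "good D y \<longleftrightarrow> P y \<and> continuity_point n f y"
    for D :: "('m \<times> 'm) set" and y
  define bad where "bad D y \<longleftrightarrow> P y \<and>
      \<not> (\<exists>E\<in>\<B>. \<forall>y'\<in>tuples U n. near E y y' \<longrightarrow> (f y, f y') \<in> D)" for D y
  have "family n good"
    unfolding family_def good_def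
    by (intro dfn_intros dfn_rel[OF P(1)] dfn_rel[OF dfn_continuity_point[OF f]] order_refl)
  moreover have "family n bad"
    unfolding family_def bad_def
    by (intro dfn_fun_mem[OF f] dfn_near[of _ n] dfn_all_tuple dfn_rel[OF P(1)] dfn_intros order_refl)
  moreover have "increasing good" unfolding increasing_def good_def by blast
  moreover have "increasing bad"
    unfolding increasing_def
  proof (intro ballI impI allI)
    fix D E y assume "E \<subseteq> D" "bad D y"
    then show "bad E y" unfolding bad_def by blast
  qed
  moreover have "has_interior n (\<lambda>y. \<exists>X\<in>{good, bad}. \<exists>D\<in>\<B>. X D y)"
  proof -
    have "(\<exists>D\<in>\<B>. good D y) \<or> (\<exists>D\<in>\<B>. bad D y)" if "P y" for y
    proof (cases "continuity_point n f y")
      case True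
      then show ?thesis using that base_nonempty unfolding good_def by blast
    next
      case False
      then show ?thesis using that unfolding bad_def continuity_point_def by blast
    qed
    then have "\<exists>X\<in>{good, bad}. \<exists>D\<in>\<B>. X D y" if "P y" for y using that by simp
    then show ?thesis using P(2) unfolding has_interior_def by meson
  qed
  ultimately obtain X D where X: "X = good \<or> X = bad" "D \<in> \<B>" "has_interior n (X D)"
    using directed_union_interior[of "{good, bad}" n] by blast
  have "\<not> has_interior n (bad D)"
  proof
    assume "has_interior n (bad D)"
    moreover have "dfn U (\<lambda>e. bad D (map e [0..<n]))"
      by (rule dfn_family[OF \<open>family n bad\<close> entourage_const[OF X(2)] tms_upt[of _ _ "\<lambda>i. i"]])
    ultimately obtain E x where E: "E \<in> \<B>" "x \<in> tuples U n" "\<And>y. near E x y \<Longrightarrow> bad D y"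
      "\<And>y y'. near E x y \<Longrightarrow> near E x y' \<Longrightarrow> (f y, f y') \<in> D"
      using small_oscillation[OF f, of "bad D" D] X(2) by blast
    have "near E x x" using E near_refl by blast
    then show False using E(1,3,4) unfolding bad_def by blast
  qed
  then have "has_interior n (good D)" using X by blast
  then show ?thesis unfolding good_def .
qed

section \<open>Uniform and product topology, and transfer to the stated form\<close>

lemma uniform_base: "uniform_base U \<B>"
proof -
  have "\<forall>D\<in>\<B>. \<exists>E\<in>\<B>. E \<subseteq> D\<inverse>"
  proof
    fix D assume D: "D \<in> \<B>"
    then have "D \<subseteq> D\<inverse>" using base_sym by auto
    then show "\<exists>E\<in>\<B>. E \<subseteq> D\<inverse>" using D by blast
  qed
  moreover have "\<forall>D\<in>\<B>. Id_on U \<subseteq> D" using base_refl by auto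
  ultimately show ?thesis unfolding uniform_base_def
    using base_nonempty base_subset base_directed base_half by (intro conjI) auto
qed

text \<open>Balls need not be open, so open sets are made from their interiors. By halving
  \<open>E'\<close>, all points near \<open>w\<close> inherit a ball inside
  \<open>E[x]\<close>.\<close>

lemma ball_interior_open:
  assumes "E \<in> \<B>"
  shows "openin (uniform_topology U \<B>) {w \<in> U. \<exists>E'\<in>\<B>. E' `` {w} \<subseteq> E `` {x}}" (is "openin _ ?O")
  unfolding openin_uniform_topology[OF uniform_base]
proof (intro conjI ballI)
  fix w assume "w \<in> ?O"
  then obtain E' where E': "E' \<in> \<B>" "E' `` {w} \<subseteq> E `` {x}" by blast
  obtain E'' where E'': "E'' \<in> \<B>" "E'' O E'' \<subseteq> E'" using base_half E'(1) by blast
  have "E'' `` {v} \<subseteq> E `` {x}" if "(w, v) \<in> E''" for v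
    using that E'' E'(2) by blast
  then have "E'' `` {w} \<subseteq> ?O" using E''(1) base_subset by blast
  then show "\<exists>D\<in>\<B>. D `` {w} \<subseteq> ?O" using E''(1) by blast
qed blast

text \<open>The open box around \<open>x\<close> is a product of interiors of balls, each of which
  contains its centre \<open>x i\<close>.\<close>

lemma openin_power_topology:
  assumes V: "V \<subseteq> power_univ M n" and near: "\<And>x. x \<in> V \<Longrightarrow>
    \<exists>E\<in>\<B>. \<forall>x'\<in>power_univ M n. near E (map x [0..<n]) (map x' [0..<n]) \<longrightarrow> x' \<in> V"
  shows "openin (power_topology U \<B> n) V"
proof (subst openin_subopen, rule ballI)
  fix x assume x: "x \<in> V"
  obtain E where E: "E \<in> \<B>"
    "\<And>x'. x' \<in> power_univ M n \<Longrightarrow> near E (map x [0..<n]) (map x' [0..<n]) \<Longrightarrow> x' \<in> V"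
    using near[OF x] by blast
  define W where "W i = {w \<in> U. \<exists>E'\<in>\<B>. E' `` {w} \<subseteq> E `` {x i}}" for i
  have "openin (power_topology U \<B> n) (Pi\<^sub>E {..<n} W)"
    unfolding power_topology_def W_def
    by (intro iffD2[OF openin_PiE] disjI2 ballI ball_interior_open E) simp
  moreover have "x \<in> Pi\<^sub>E {..<n} W"
    using x V E(1) unfolding power_univ_def W_def by (auto simp: PiE_def Pi_def)
  moreover have "Pi\<^sub>E {..<n} W \<subseteq> V"
  proof
    fix x' assume x': "x' \<in> Pi\<^sub>E {..<n} W"
    have "x' \<in> power_univ M n"
      using x' unfolding power_univ_def W_def by (auto simp: PiE_def Pi_def)
    moreover have "(x i, x' i) \<in> E" if i: "i < n" for i
    proof -
      have "x' i \<in> W i" using x' i by auto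
      then show ?thesis unfolding W_def using base_refl by blast
    qed
    then have "near E (map x [0..<n]) (map x' [0..<n])" by (simp add: list_all2_conv_all_nth)
    ultimately show "x' \<in> V" using E(2) by blast
  qed
  ultimately show "\<exists>T. openin (power_topology U \<B> n) T \<and> x \<in> T \<and> T \<subseteq> V" by blast
qed

lemma generic_continuity:
  assumes A: "open_ball U \<B> n A" and f: "definable_function L M n A f"
  shows "\<exists>V. V \<noteq> {} \<and> V \<subseteq> A \<and> openin (power_topology U \<B> n) V \<and> definable L M n V \<and>
    continuous_map (subtopology (power_topology U \<B> n) V) (uniform_topology U \<B>) f"
proof -
  define pt where "pt c = restrict ((!) c) {..<n}" for c :: "'m list"
  have pt_map: "pt (map e [0..<n]) = restrict e {..<n}" for e
    by (auto simp: pt_def)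
  have pt_power: "pt (map x [0..<n]) = x" if "x \<in> power_univ M n" for x
    using that unfolding pt_map power_univ_def by (simp add: PiE_restrict)
  have map_power: "map x [0..<n] \<in> tuples U n" if "x \<in> power_univ M n" for x
    using PiE_mem[OF that[unfolded power_univ_def]] by (auto simp: tuples_def)
  obtain a0 where a0: "a0 \<in> U" using nonempty by blast
  have AU: "A \<subseteq> power_univ M n" and fU: "f \<in> A \<rightarrow> U"
    and G: "definable L M (Suc n)
       {z \<in> power_univ M (Suc n). restrict z {..<n} \<in> A \<and> z n = f (restrict z {..<n})}"
    using f unfolding definable_function_def by auto
  define P where "P c \<longleftrightarrow> pt c \<in> A" for c
  \<comment> \<open>The preceding results concern total functions, so \<open>f\<close> is continued
    by the constant \<open>a0\<close> outside \<open>A\<close>; on \<open>V\<close> the two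
    agree.\<close>
  define g where "g c = (if P c then f (pt c) else a0)" for c
  have gU: "g c \<in> U" for c using fU a0 by (auto simp: g_def P_def)

  have "dfn U (\<lambda>e. restrict e {..<n} \<in> A \<and> e n = f (restrict e {..<n}))"
  proof -
    have "restrict e {..<Suc n} \<in> power_univ M (Suc n)" if "e \<in> envs" for e
      using that by (auto simp: power_univ_def)
    moreover have "restrict (restrict e {..<Suc n}) {..<n} = restrict e {..<n}" for e :: "nat \<Rightarrow> 'm"
      by auto
    ultimately show ?thesis
      using iffD1[OF dfn_cong dfn_if_definable[OF G]] by simp
  qed
  \<comment> \<open>The graph has the value in its last coordinate \<open>n\<close>; the
    substitution brings it to variable \<open>0\<close>.\<close>
  from dfn_subst[OF this, of "\<lambda>i. if i < n then (\<lambda>e. e (Suc i)) else (\<lambda>e. e 0)"]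
  have graph: "dfn U (\<lambda>e. P (map (\<lambda>i. e (Suc i)) [0..<n]) \<and> e 0 = f (pt (map (\<lambda>i. e (Suc i)) [0..<n])))"
    unfolding P_def pt_map by (simp add: tm_var restrict_def if_distribR cong: if_cong)
  \<comment> \<open>Definability of \<open>A\<close> is read off from the graph, whose projection it
    is.\<close>
  then have "dfn U (\<lambda>e. \<exists>a\<in>U. P (map e [0..<n]) \<and> a = f (pt (map e [0..<n])))"
    by (rule dfn_ex)
  moreover have "(\<exists>a\<in>U. P c \<and> a = f (pt c)) \<longleftrightarrow> P c" for c
    using fU unfolding P_def by auto
  ultimately have P: "dfn U (\<lambda>e. P (map e [0..<n]))" by simp
  have "dfn U (\<lambda>e. P (map (\<lambda>i. e (Suc i)) [0..<n]) \<and> e 0 = f (pt (map (\<lambda>i. e (Suc i)) [0..<n])) \<or>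
      \<not> P (map (\<lambda>i. e (Suc i)) [0..<n]) \<and> e 0 = a0)"
    by (intro dfn_disj graph dfn_conj dfn_neg dfn_rel[OF P] tms_upt dfn_eq tm_var tm_const a0 order_refl)
  moreover have "P c \<and> a = f (pt c) \<or> \<not> P c \<and> a = a0 \<longleftrightarrow> a = g c" for a c
    by (auto simp: g_def)
  ultimately have g: "dfn_fun n g" unfolding dfn_fun_def using gU by simp

  have "has_interior n P"
  proof -
    obtain D x where D: "\<And>i. i < n \<Longrightarrow> D i \<in> \<B> \<and> x i \<in> U" "A = (\<Pi>\<^sub>E i\<in>{..<n}. D i `` {x i})"
      using A unfolding open_ball_def by blast
    have "finite (D ` {..<n})" "D ` {..<n} \<subseteq> \<B>" using D(1) by auto
    then obtain E where E: "E \<in> \<B>" "\<forall>D'\<in>D ` {..<n}. E \<subseteq> D'" using base_lower_bound by meson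
    have "P c" if "near E (map x [0..<n]) c" for c
      using that E(2) unfolding P_def pt_def D(2) by (auto simp: list_all2_conv_all_nth)
    moreover have "map x [0..<n] \<in> tuples U n" using D(1) by (auto simp: tuples_def)
    ultimately show ?thesis unfolding has_interior_def using E(1) by blast
  qed
  then obtain D x where D: "D \<in> \<B>" "x \<in> tuples U n"
    "\<And>y. near D x y \<Longrightarrow> P y \<and> continuity_point n g y"
    using continuity_points_interior[OF g P] unfolding has_interior_def by blast

  \<comment> \<open>A box of balls need not be open, so \<open>V\<close> is the interior of the set
    of continuity points in \<open>P\<close>, written with entourages to keep it definable.\<close>
  define S where "S y \<longleftrightarrow> (\<exists>E\<in>\<B>. \<forall>y'\<in>tuples U n. near E y y' \<longrightarrow> P y' \<and> continuity_point n g y')" for y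
  define V where "V = {x \<in> power_univ M n. S (map x [0..<n])}"
  have dfnS: "dfn U (\<lambda>e. S (map e [0..<n]))"
    unfolding S_def
    by (intro dfn_intros dfn_near[of _ n] dfn_all_tuple dfn_rel[OF P] dfn_rel[OF dfn_continuity_point[OF g]] order_refl)
  have defV: "definable L M n V"
    unfolding V_def
  proof (rule definable_if_dfn[OF dfnS])
    fix x e :: "nat \<Rightarrow> 'm" assume "\<And>i. i < n \<Longrightarrow> e i = x i"
    then have "map x [0..<n] = map e [0..<n]" by simp
    then show "S (map x [0..<n]) \<longleftrightarrow> S (map e [0..<n])" by (simp only:)
  qed
  have S_open: "\<exists>E\<in>\<B>. \<forall>y'. near E y y' \<longrightarrow> S y'" if y: "y \<in> tuples U n" "S y" for y
  proof -
    obtain E where E: "E \<in> \<B>" "\<And>y'. y' \<in> tuples U n \<Longrightarrow> near E y y' \<Longrightarrow> P y' \<and> continuity_point n g y'"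
      using y(2) unfolding S_def by blast
    obtain E' where E': "E' \<in> \<B>" "E' O E' \<subseteq> E" using base_half E(1) by blast
    have "near E y y''" if "near E' y y'" "near E' y' y''" for y' y''
      using list_all2_trans[OF _ that, of "\<lambda>a b. (a, b) \<in> E"] E'(2) by blast
    then show ?thesis using E E' unfolding S_def by blast
  qed
  have SP: "P y \<and> continuity_point n g y" if "S y" "y \<in> tuples U n" for y
    using that near_refl unfolding S_def by blast
  have VA: "V \<subseteq> A"
    using SP map_power pt_power unfolding V_def P_def by fastforce
  have gf: "g (map x [0..<n]) = f x" if "x \<in> V" for x
    using that VA pt_power unfolding g_def P_def V_def by auto
  have "pt x \<in> V"
  proof -
    have "map (pt x) [0..<n] = x" using D(2) by (auto simp: pt_def tuples_def intro!: nth_equalityI)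
    moreover have "pt x \<in> power_univ M n"
      using D(2) unfolding power_univ_def pt_def tuples_def by auto
    moreover have "S x" using D unfolding S_def by blast
    ultimately show ?thesis unfolding V_def by simp
  qed
  then have "V \<noteq> {}" by blast
  moreover have openV: "openin (power_topology U \<B> n) V"
  proof (rule openin_power_topology)
    fix x assume "x \<in> V"
    then show "\<exists>E\<in>\<B>. \<forall>x'\<in>power_univ M n. near E (map x [0..<n]) (map x' [0..<n]) \<longrightarrow> x' \<in> V"
      using S_open[of "map x [0..<n]"] map_power unfolding V_def by blast
  qed (auto simp: V_def)
  moreover have "continuous_map (subtopology (power_topology U \<B> n) V) (uniform_topology U \<B>) f"
    unfolding continuous_map_def
  proof (intro conjI allI impI)
    have top: "topspace (subtopology (power_topology U \<B> n) V) = V"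
      using openin_subset[OF openV] by (simp add: Int_absorb1)
    show "f \<in> topspace (subtopology (power_topology U \<B> n) V) \<rightarrow> topspace (uniform_topology U \<B>)"
      unfolding top topspace_uniform_topology[OF uniform_base] using VA fU by blast
    fix W assume W: "openin (uniform_topology U \<B>) W"
    have "openin (power_topology U \<B> n) {x \<in> V. f x \<in> W}"
    proof (rule openin_power_topology)
      fix x assume x: "x \<in> {x \<in> V. f x \<in> W}"
      then have xU: "x \<in> power_univ M n" "map x [0..<n] \<in> tuples U n" "S (map x [0..<n])"
        using map_power unfolding V_def by auto
      obtain D where D: "D \<in> \<B>" "D `` {f x} \<subseteq> W"
        using W x unfolding openin_uniform_topology[OF uniform_base] by blast
      obtain E where E: "E \<in> \<B>" "\<And>y'. y' \<in> tuples U n \<Longrightarrow> near E (map x [0..<n]) y' \<Longrightarrow>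
          (g (map x [0..<n]), g y') \<in> D"
        using SP[OF xU(3,2)] D(1) unfolding continuity_point_def by blast
      obtain E' where E': "E' \<in> \<B>" "\<And>y'. near E' (map x [0..<n]) y' \<Longrightarrow> S y'"
        using S_open[OF xU(2,3)] by blast
      \<comment> \<open>\<open>E\<close> keeps the value of \<open>g\<close> within
        \<open>D\<close>; \<open>E'\<close> keeps the point in \<open>V\<close>, where
        \<open>g\<close> agrees with \<open>f\<close>.\<close>
      obtain E'' where E'': "E'' \<in> \<B>" "E'' \<subseteq> E \<inter> E'" using base_directed E(1) E'(1) by blast
      have "x' \<in> {x \<in> V. f x \<in> W}"
        if x': "x' \<in> power_univ M n" "near E'' (map x [0..<n]) (map x' [0..<n])" for x'
      proof -
        have n: "near E (map x [0..<n]) (map x' [0..<n])" "near E' (map x [0..<n]) (map x' [0..<n])"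
          using near_mono[OF x'(2)] E''(2) by auto
        have V': "x' \<in> V" using E'(2)[OF n(2)] x'(1) unfolding V_def by blast
        have "(f x, f x') \<in> D"
          using E(2)[OF map_power[OF x'(1)] n(1)] gf[OF V'] gf[of x] x by simp
        then show ?thesis using V' D(2) by blast
      qed
      then show "\<exists>E\<in>\<B>. \<forall>x'\<in>power_univ M n. near E (map x [0..<n]) (map x' [0..<n]) \<longrightarrow>
          x' \<in> {x \<in> V. f x \<in> W}"
        using E''(1) by blast
    qed (auto simp: V_def)
    then show "openin (subtopology (power_topology U \<B> n) V)
        {x \<in> topspace (subtopology (power_topology U \<B> n) V). f x \<in> W}"
      unfolding top by (simp add: openin_open_subtopology[OF openV])
  qed
  ultimately show ?thesis using VA defV by blast
qed

end

section \<open>From the given definitions to the locale\<close>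

lemma visceral_structureI:
  assumes "is_structure L M" "omega_saturated L M" "visceral L M \<B>"
  shows "\<exists>k Dset \<psi>. visceral_structure L M \<B> k Dset \<psi>"
proof -
  interpret fo_structure L M
    using assms(1) unfolding is_structure_def by unfold_locales blast
  have dus: "definable_uniform_structure L M \<B>"
    using assms(3) unfolding visceral_def by (elim conjE)
  have ub: "uniform_base U \<B>" and sym: "\<And>D. D \<in> \<B> \<Longrightarrow> sym D"
    and proper: "\<And>D x. D \<in> \<B> \<Longrightarrow> x \<in> U \<Longrightarrow> \<exists>E\<in>\<B>. E `` {x} \<subset> D `` {x}"
    and int: "\<And>A. definable_subset L M A \<Longrightarrow> infinite A \<Longrightarrow> uniform_topology U \<B> interior_of A \<noteq> {}"
    using assms(3) dus unfolding visceral_def definable_uniform_structure_def by auto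
  obtain k \<phi> \<psi> e0 where e0: "e0 \<in> envs" and fm: "is_fm L \<phi>" "is_fm L \<psi>"
    and B: "\<B> = {{(x, y) \<in> U \<times> U. sat M ((override_on e0 b {..<k})(k := x, Suc k := y)) \<phi>} | b.
              b \<in> power_univ M k \<and> sat M (override_on e0 b {..<k}) \<psi>}"
    using dus unfolding definable_uniform_structure_def by (elim conjE exE bexE)
  \<comment> \<open>Only the first \<open>k\<close> entries of \<open>b\<close> are read, so tuples
    as lists and as extensional functions yield the same entourages.\<close>
  define Dset where "Dset b = {(x, y) \<in> U \<times> U.
      sat M ((override_on e0 ((!) b) {..<k})(k := x, Suc k := y)) \<phi>}" for b
  define \<psi>' where "\<psi>' b \<longleftrightarrow> sat M (override_on e0 ((!) b) {..<k}) \<psi>" for b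
  have ov_map: "override_on e0 ((!) (map e [0..<k])) {..<k} = override_on e0 e {..<k}" for e
    by (auto simp: override_on_def)
  have ov_restrict: "override_on e0 (restrict e {..<k}) {..<k} = override_on e0 e {..<k}" for e
    by (auto simp: override_on_def)
  have "\<B> = {Dset b | b. b \<in> tuples U k \<and> \<psi>' b}"
  proof (intro equalityI subsetI)
    fix D assume "D \<in> \<B>"
    then obtain b where b: "b \<in> power_univ M k" "sat M (override_on e0 b {..<k}) \<psi>"
      "D = {(x, y) \<in> U \<times> U. sat M ((override_on e0 b {..<k})(k := x, Suc k := y)) \<phi>}"
      unfolding B mem_Collect_eq by (elim exE conjE)
    have "D = Dset (map b [0..<k])" "\<psi>' (map b [0..<k])"
      using b unfolding Dset_def \<psi>'_def ov_map by auto
    moreover have "map b [0..<k] \<in> tuples U k"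
      using PiE_mem[OF b(1)[unfolded power_univ_def]] by (auto simp: tuples_def)
    ultimately show "D \<in> {Dset b | b. b \<in> tuples U k \<and> \<psi>' b}" by blast
  next
    fix D assume "D \<in> {Dset b | b. b \<in> tuples U k \<and> \<psi>' b}"
    then obtain b where b: "b \<in> tuples U k" "\<psi>' b" "D = Dset b" by blast
    have "b ! i \<in> U" if "i < k" for i
      using b(1) that nth_mem[of i b] unfolding tuples_def by blast
    then have "restrict ((!) b) {..<k} \<in> power_univ M k"
      unfolding power_univ_def restrict_PiE_iff by blast
    moreover have "sat M (override_on e0 (restrict ((!) b) {..<k}) {..<k}) \<psi>"
      using b(2) unfolding \<psi>'_def ov_restrict .
    moreover have "D = {(x, y) \<in> U \<times> U.
        sat M ((override_on e0 (restrict ((!) b) {..<k}) {..<k})(k := x, Suc k := y)) \<phi>}"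
      unfolding b(3) Dset_def ov_restrict ..
    ultimately show "D \<in> \<B>" unfolding B mem_Collect_eq by (intro exI conjI)
  qed
  moreover have "dfn U (\<lambda>e. \<psi>' (map e [0..<k]))"
  proof -
    have "dfn U (\<lambda>e. sat M (\<lambda>i. (if i < k then (\<lambda>e. e i) else (\<lambda>e. e0 i)) e) \<psi>)"
      using e0 by (intro dfn_sat fm) (auto intro: tm_var tm_const)
    moreover have "(\<lambda>i. (if i < k then (\<lambda>e. e i) else (\<lambda>e. e0 i)) e) = override_on e0 e {..<k}" for e
      by (auto simp: override_on_def)
    ultimately show ?thesis unfolding \<psi>'_def ov_map by simp
  qed
  moreover have "dfn U (\<lambda>e. (e k, e (Suc k)) \<in> Dset (map e [0..<k]))"
  proof -
    \<comment> \<open>The variables \<open>k\<close> and \<open>k + 1\<close> hold the two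
      coordinates, so \<open>k + 2\<close> variables come from the context and all later ones keep
      their parameter values.\<close>
    have "dfn U (\<lambda>e. sat M (\<lambda>i. (if i < k + 2 then (\<lambda>e. e i) else (\<lambda>e. e0 i)) e) \<phi>)"
      using e0 by (intro dfn_sat fm) (auto intro: tm_var tm_const)
    moreover have "(\<lambda>i. (if i < k + 2 then (\<lambda>e. e i) else (\<lambda>e. e0 i)) e) =
        (override_on e0 e {..<k})(k := e k, Suc k := e (Suc k))" for e
      by (auto simp: override_on_def fun_eq_iff)
    ultimately have "dfn U (\<lambda>e. sat M ((override_on e0 e {..<k})(k := e k, Suc k := e (Suc k))) \<phi>)"
      by simp
    then show ?thesis
      by (rule iffD1[OF dfn_cong, rotated]) (auto simp: Dset_def ov_map Pi_def)
  qed
  moreover have "\<exists>D\<in>\<B>. \<exists>x\<in>U. \<forall>w. (x, w) \<in> D \<longrightarrow> P w"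
    if P: "dfn U (\<lambda>e. P (e 0))" "infinite {z \<in> U. P z}" for P
  proof -
    have "definable L M 1 {x \<in> power_univ M 1. x 0 \<in> {z \<in> U. P z}}"
      by (rule definable_if_dfn[OF P(1)]) (auto simp: power_univ_def)
    then have "definable_subset L M {z \<in> U. P z}" unfolding definable_subset_def by blast
    then obtain x where "x \<in> uniform_topology U \<B> interior_of {z \<in> U. P z}" using int P(2) by blast
    then obtain W where "openin (uniform_topology U \<B>) W" "x \<in> W" "W \<subseteq> {z \<in> U. P z}"
      unfolding interior_of_def by blast
    then show ?thesis unfolding openin_uniform_topology[OF ub] by blast
  qed
  ultimately have "visceral_structure L M \<B> k Dset \<psi>'"
    using assms(2) ub sym proper
    by unfold_locales (auto simp: uniform_base_def dest: symD)
  then show ?thesis by blast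
qed

theorem theorem3p13:
  fixes L :: "('f, 'r) lang" and T :: "('f, 'r) fm set"
    and M :: "('f, 'r, 'm) struct" and \<B> :: "('m \<times> 'm) set set"
    and n :: nat and B :: "(nat \<Rightarrow> 'm) set" and f :: "(nat \<Rightarrow> 'm) \<Rightarrow> 'm"
  assumes "complete_theory L T"
    and "visceral_theory TYPE('n) L T"
    and "is_model L T M"
    and "omega_saturated L M"
    and "visceral L M \<B>"
    and "open_ball (univ M) \<B> n B"
    and "definable_function L M n B f"
  shows "\<exists>U. U \<noteq> {} \<and> U \<subseteq> B \<and> openin (power_topology (univ M) \<B> n) U \<and> definable L M n U \<and>
    continuous_map (subtopology (power_topology (univ M) \<B> n) U) (uniform_topology (univ M) \<B>) f"
proof -
  have "is_structure L M" using assms(3) unfolding is_model_def by blast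
  then obtain k Dset \<psi> where "visceral_structure L M \<B> k Dset \<psi>"
    using visceral_structureI assms(4,5) by blast
  then show ?thesis using assms(6,7) by (rule visceral_structure.generic_continuity)
qed

end
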